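(* Let $\alpha\in(0,1]$, and let $\mathcal{F}$ be a topological space of Lipschitz self-maps on a compact metric space $(X,d)$. If $f\in\mathcal{F}$ is $\mathcal{F}$-stably hyperbolic, and $\mathcal{O}$ is an $f$-periodic orbit, then there exist a neighbourhood $U$ of $f$, and $C>0$, such that for all $g\in U$, the following hold: (i) The maps $h_g\colon\Omega(f)\to\Omega(g)$ and $i_g\colon\Omega(g)\to\Omega(f)$ in condition (IS) of the definition of $\mathcal{F}$-stable hyperbolicity exist. (ii) If $\mathcal{O}_g=h_g(\mathcal{O})$, $d_g=\max\{d_\infty(h_g,\mathrm{id}),\,d_\infty(i_g,\mathrm{id})\}$, and a nonconstant function $\phi\in C^{0,\alpha}(X,\mathbb{R})$ satisfies $\mathcal{M}_{\max}(f,\phi)=\{\mu_{\mathcal{O}}\}$, then $$\{\mu_{\mathcal{O}_g}\}=\mathcal{M}_{\max}\bigl(g,\ \phi-2C\,|\phi|_\alpha\,d_g^{\alpha/2}\,d(\cdot,\mathcal{O}_g)^\alpha+\xi\bigr)$$ for all $\xi\in C^{0,\alpha}(X,\mathbb{R})$ satisfying $|\xi|_\alpha\le5C|\phi|_\alpha d_g^{\alpha/2}$ and $\|\xi\|_\infty\le|\phi|_\alpha d_g^\alpha$.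
   Context: Notation. $\Omega(f)$ is the nonwandering set of $f$: the complement of the set of points $x$ having a neighbourhood $V$ with $f^n(V)\cap V=\emptyset$ for all $n\ge1$. $\operatorname{LIP}(f)$ is the optimal Lipschitz constant of $f$. $d_\infty(h,\mathrm{id})=\sup_x d(h(x),x)$ over the domain of $h$. $C^{0,\alpha}(X,\mathbb{R})$ is the space of real-valued $\alpha$-Hölder functions on $X$, $|\phi|_{\alpha}=\sup_{x\neq y}|\phi(x)-\phi(y)|/d(x,y)^\alpha$, $\|\phi\|_\infty=\sup|\phi|$. $Q(f,\phi)=\sup\int\phi\,d\mu$ over $f$-invariant Borel probability measures $\mu$; $\mathcal{M}_{\max}(f,\phi)$ is the set of $f$-invariant Borel probability measures attaining this supremum. For a periodic orbit $\mathcal{O}$, $\mu_{\mathcal{O}}=\frac1{\operatorname{card}\mathcal{O}}\sum_{x\in\mathcal{O}}\delta_x$. Definition. $f\in\mathcal{F}$ is $\mathcal{F}$-stably hyperbolic if: (IS) For every $\varepsilon>0$ there is a neighbourhood $U$ of $f$ in $\mathcal{F}$ such that if $g\in U$ then $\operatorname{LIP}(g)<2\operatorname{LIP}(f)$ and there exist maps $h_g\colon\Omega(f)\to\Omega(g)$, $i_g\colon\Omega(g)\to\Omega(f)$ with $h_g\circ f=g\circ h_g$, $i_g\circ g=f\circ i_g$, $d_\infty(h_g,\mathrm{id})<\varepsilon$, $d_\infty(i_g,\mathrm{id})<\varepsilon$. (RHE) There are a neighbourhood $U$ of $f$ and constants $K>0$, $\delta>0$, $\lambda>1$ such that for all $g\in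 U$, $x,y\in\Omega(g)$, $n\in\mathbb{N}$: if $\max_{0\le m\le n}d(g^m(x),g^m(y))<\delta$, then $d(g^m(x),g^m(y))\le K\lambda^{-\min\{m,n-m\}}(d(x,y)+d(g^n(x),g^n(y)))$ for all $0\le m\le n$. (ML) For every $\alpha\in(0,1]$ there is $L>0$ such that for all $\phi\in C^{0,\alpha}(X,\mathbb{R})$ there is $u\in C^{0,\alpha}(\Omega(f),\mathbb{R})$ with $\phi+u-u\circ f\le Q(f,\phi)$ on $\Omega(f)$ and $|u|_\alpha\le L|\phi|_\alpha$. *)

theory Defs
  imports "HOL-Probability.Probability"
begin

definition lipschitz_map :: "('a::metric_space \<Rightarrow> 'a) \<Rightarrow> bool" where
  "lipschitz_map f \<longleftrightarrow> (\<exists>L. L-lipschitz_on UNIV f)"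

definition LIP :: "('a::metric_space \<Rightarrow> 'a) \<Rightarrow> real" where
  "LIP f = Inf {L. L-lipschitz_on UNIV f}"

definition nonwandering :: "('a::topological_space \<Rightarrow> 'a) \<Rightarrow> 'a set" where
  "nonwandering f = - {x. \<exists>V. open V \<and> x \<in> V \<and> (\<forall>n\<ge>1. (f ^^ n) ` V \<inter> V = {})}"

definition periodic_orbit :: "('a \<Rightarrow> 'a) \<Rightarrow> 'a set \<Rightarrow> bool" where
  "periodic_orbit f Orb \<longleftrightarrow>
     (\<exists>x p. p > 0 \<and> (f ^^ p) x = x \<and> Orb = range (\<lambda>n. (f ^^ n) x))"

definition sup_dist_id :: "'a::metric_space set \<Rightarrow> ('a \<Rightarrow> 'a) \<Rightarrow> real" where
  "sup_dist_id S h = (SUP x\<in>S. dist (h x) x)"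

definition holder_on :: "real \<Rightarrow> 'a::metric_space set \<Rightarrow> ('a \<Rightarrow> real) \<Rightarrow> bool" where
  "holder_on \<alpha> S \<phi> \<longleftrightarrow> (\<exists>C. \<forall>x\<in>S. \<forall>y\<in>S. \<bar>\<phi> x - \<phi> y\<bar> \<le> C * dist x y powr \<alpha>)"

(* Inserting 0 does not change the supremum of a nonempty set of nonnegative quotients; it makes
   the seminorm 0 when S has at most one point (the real supremum of the empty set is unspecified). *)
definition holder_seminorm :: "real \<Rightarrow> 'a::metric_space set \<Rightarrow> ('a \<Rightarrow> real) \<Rightarrow> real" where
  "holder_seminorm \<alpha> S \<phi> =
     Sup (insert 0 {\<bar>\<phi> x - \<phi> y\<bar> / dist x y powr \<alpha> | x y. x \<in> S \<and> y \<in> S \<and> x \<noteq> y})"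

definition sup_norm :: "('a \<Rightarrow> real) \<Rightarrow> real" where
  "sup_norm \<phi> = (SUP x. \<bar>\<phi> x\<bar>)"

definition invariant_measures :: "('a::topological_space \<Rightarrow> 'a) \<Rightarrow> 'a measure set" where
  "invariant_measures f = {\<mu>. sets \<mu> = sets borel \<and> prob_space \<mu> \<and> distr \<mu> borel f = \<mu>}"

definition max_integral :: "('a::topological_space \<Rightarrow> 'a) \<Rightarrow> ('a \<Rightarrow> real) \<Rightarrow> real" where
  "max_integral f \<phi> = (SUP \<mu>\<in>invariant_measures f. integral\<^sup>L \<mu> \<phi>)"

definition maximizing_measures ::
    "('a::topological_space \<Rightarrow> 'a) \<Rightarrow> ('a \<Rightarrow> real) \<Rightarrow> 'a measure set" where
  "maximizing_measures f \<phi> = {\<mu> \<in> invariant_measures f. integral\<^sup>L \<mu> \<phi> = max_integral f \<phi>}"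

definition orbit_measure :: "'a::topological_space set \<Rightarrow> 'a measure" where
  "orbit_measure Orb =
     measure_of UNIV (sets borel)
       (\<lambda>A. ennreal (1 / real (card Orb)) * (\<Sum>x\<in>Orb. emeasure (return borel x) A))"

(* h and i are total functions of which only the restrictions to the nonwandering sets matter.
   They are not required to be continuous, injective or surjective. *)
definition semiconj_pair ::
    "real \<Rightarrow> ('a::metric_space \<Rightarrow> 'a) \<Rightarrow> ('a \<Rightarrow> 'a) \<Rightarrow> ('a \<Rightarrow> 'a) \<Rightarrow> ('a \<Rightarrow> 'a) \<Rightarrow> bool" where
  "semiconj_pair \<epsilon> f g h i \<longleftrightarrow>
     h \<in> nonwandering f \<rightarrow> nonwandering g \<and>
     i \<in> nonwandering g \<rightarrow> nonwandering f \<and>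
     (\<forall>x\<in>nonwandering f. h (f x) = g (h x)) \<and>
     (\<forall>x\<in>nonwandering g. i (g x) = f (i x)) \<and>
     sup_dist_id (nonwandering f) h < \<epsilon> \<and>
     sup_dist_id (nonwandering g) i < \<epsilon>"

definition cond_IS :: "('a::metric_space \<Rightarrow> 'a) topology \<Rightarrow> ('a \<Rightarrow> 'a) \<Rightarrow> bool" where
  "cond_IS F f \<longleftrightarrow>
     (\<forall>\<epsilon>>0. \<exists>U. openin F U \<and> f \<in> U \<and>
        (\<forall>g\<in>U. LIP g < 2 * LIP f \<and> (\<exists>h i. semiconj_pair \<epsilon> f g h i)))"

definition cond_RHE :: "('a::metric_space \<Rightarrow> 'a) topology \<Rightarrow> ('a \<Rightarrow> 'a) \<Rightarrow> bool" where
  "cond_RHE F f \<longleftrightarrow>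
     (\<exists>U K \<delta> \<kappa>. openin F U \<and> f \<in> U \<and> K > 0 \<and> \<delta> > 0 \<and> \<kappa> > 1 \<and>
        (\<forall>g\<in>U. \<forall>x\<in>nonwandering g. \<forall>y\<in>nonwandering g. \<forall>n::nat.
           (MAX m\<in>{0..n}. dist ((g ^^ m) x) ((g ^^ m) y)) < \<delta> \<longrightarrow>
           (\<forall>m\<in>{0..n}. dist ((g ^^ m) x) ((g ^^ m) y)
              \<le> K * \<kappa> powr (- real (min m (n - m)))
                  * (dist x y + dist ((g ^^ n) x) ((g ^^ n) y)))))"

definition cond_ML :: "('a::metric_space \<Rightarrow> 'a) \<Rightarrow> bool" where
  "cond_ML f \<longleftrightarrow>
     (\<forall>\<alpha>. 0 < \<alpha> \<and> \<alpha> \<le> 1 \<longrightarrow>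
        (\<exists>L>0. \<forall>\<phi>. holder_on \<alpha> UNIV \<phi> \<longrightarrow>
           (\<exists>u. holder_on \<alpha> (nonwandering f) u \<and>
                (\<forall>x\<in>nonwandering f. \<phi> x + u x - u (f x) \<le> max_integral f \<phi>) \<and>
                holder_seminorm \<alpha> (nonwandering f) u \<le> L * holder_seminorm \<alpha> UNIV \<phi>)))"

definition stably_hyperbolic :: "('a::metric_space \<Rightarrow> 'a) topology \<Rightarrow> ('a \<Rightarrow> 'a) \<Rightarrow> bool" where
  "stably_hyperbolic F f \<longleftrightarrow>
     f \<in> topspace F \<and> cond_IS F f \<and> cond_RHE F f \<and> cond_ML f"

end

theory Submission
  imports Defs
begin

text \<open>
  Write P for the image of the orbit under h, d for the distance d_g, and A for the Hoelder seminorm of \<phi>.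
  Transporting the sub-action u of (ML) to v = u \<circ> i on the nonwandering set of g makes the
  cohomologous function \<phi> + v - v \<circ> g at most Q(f,\<phi>) + A d^\<alpha>, while the average over P loses only
  A d^\<alpha>.  So each step of a g-orbit gains at most 4 A d^\<alpha> over the average \<beta> on P, and each visit to the
  region at distance at least a fixed \<rho> from P costs about 2 C A d^(\<alpha>/2) \<rho>^\<alpha>, which is of larger order.

  During a run inside the \<rho>-neighbourhood the orbit shadows P, and (RHE) makes the distance decay
  exponentially towards the middle of the run.  It exceeds d on O(log(1/d)) steps only, which contribute
  O(A d^\<alpha> log(1/d)); on the remaining steps the Birkhoff sums of the two orbits differ by
  O(A d^\<alpha>), and the discontinuity of v matters only at the two ends.  The whole run is thus paid for by
  the next visit to the far region.  Integrating, an invariant measure with integral at least \<beta> gives no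
  mass to the far region; its typical orbits then converge to P, so that it is the measure on P.
\<close>

subsection \<open>Lipschitz and Hoelder estimates\<close>

text \<open>The infimum \<open>LIP g\<close> is itself a Lipschitz constant: for distinct points the
  difference quotient is a lower bound of the set of all Lipschitz constants, which is nonempty by
  hypothesis.\<close>

lemma dist_le_LIP:
  assumes "lipschitz_map g"
  shows "dist (g x) (g y) \<le> LIP g * dist x y"
proof (cases "x = y")
  case False
  have "dist (g x) (g y) / dist x y \<le> LIP g"
    unfolding LIP_def
  proof (rule cInf_greatest)
    show "{L. L-lipschitz_on UNIV g} \<noteq> {}"
      using assms by (auto simp: lipschitz_map_def)
    fix L assume "L \<in> {L. L-lipschitz_on UNIV g}"
    then have "dist (g x) (g y) \<le> L * dist x y"
      by (auto dest: lipschitz_onD)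
    then show "dist (g x) (g y) / dist x y \<le> L"
      using False by (simp add: field_simps)
  qed
  then show ?thesis
    using False by (simp add: field_simps)
qed simp

lemma lipschitz_map_continuous: "lipschitz_map g \<Longrightarrow> continuous_on UNIV g"
  by (auto simp: lipschitz_map_def intro: lipschitz_on_continuous_on)

lemma LIP_nonneg:
  assumes "lipschitz_map g"
  shows "0 \<le> LIP g"
  unfolding LIP_def
proof (rule cInf_greatest)
  show "{L. L-lipschitz_on UNIV g} \<noteq> {}"
    using assms by (auto simp: lipschitz_map_def)
qed (auto dest: lipschitz_on_nonneg)

text \<open>A real \<open>Sup\<close> is meaningful only on a bounded set. The bound
  \<open>max 0 C\<close> allows for the inserted 0, since \<open>C\<close> may be negative when
  \<open>S\<close> has at most one point.\<close>

lemma holder_seminorm_bdd_above: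
  assumes "holder_on \<alpha> S \<phi>"
  shows "bdd_above (insert 0 {\<bar>\<phi> x - \<phi> y\<bar> / dist x y powr \<alpha> | x y. x \<in> S \<and> y \<in> S \<and> x \<noteq> y})"
proof -
  from assms obtain C where C: "\<And>x y. x \<in> S \<Longrightarrow> y \<in> S \<Longrightarrow> \<bar>\<phi> x - \<phi> y\<bar> \<le> C * dist x y powr \<alpha>"
    by (auto simp: holder_on_def)
  have "\<bar>\<phi> x - \<phi> y\<bar> / dist x y powr \<alpha> \<le> C" if "x \<in> S" "y \<in> S" "x \<noteq> y" for x y
    using C[OF that(1,2)] that(3) by (simp add: field_simps)
  then show ?thesis
    by (auto intro!: bdd_aboveI[of _ "max 0 C"] simp: le_max_iff_disj)
qed

lemma holder_seminorm_nonneg: "holder_on \<alpha> S \<phi> \<Longrightarrow> 0 \<le> holder_seminorm \<alpha> S \<phi>"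
  unfolding holder_seminorm_def by (intro cSup_upper holder_seminorm_bdd_above) auto

lemma holder_bound:
  assumes "holder_on \<alpha> S \<phi>" "x \<in> S" "y \<in> S"
  shows "\<bar>\<phi> x - \<phi> y\<bar> \<le> holder_seminorm \<alpha> S \<phi> * dist x y powr \<alpha>"
proof (cases "x = y")
  case False
  have "\<bar>\<phi> x - \<phi> y\<bar> / dist x y powr \<alpha> \<le> holder_seminorm \<alpha> S \<phi>"
    unfolding holder_seminorm_def using assms False
    by (intro cSup_upper holder_seminorm_bdd_above) auto
  then show ?thesis
    using False by (simp add: field_simps)
qed simp

text \<open>Strict positivity of the seminorm later makes the cost of a far visit strictly positive;
  it is drawn from \<phi> being nonconstant.\<close>

lemma holder_seminorm_pos:
  assumes "holder_on \<alpha> UNIV \<phi>" "\<not> \<phi> constant_on UNIV"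
  shows "0 < holder_seminorm \<alpha> UNIV \<phi>"
proof (rule ccontr)
  assume "\<not> 0 < holder_seminorm \<alpha> UNIV \<phi>"
  then have "holder_seminorm \<alpha> UNIV \<phi> = 0"
    using holder_seminorm_nonneg[OF assms(1)] by simp
  then have "\<phi> x = \<phi> y" for x y
    using holder_bound[OF assms(1), of x y] by simp
  then show False
    using assms(2) unfolding constant_on_def by blast
qed

lemma holder_on_continuous:
  assumes "holder_on \<alpha> S \<phi>" "0 < \<alpha>"
  shows "continuous_on S \<phi>"
  unfolding continuous_on_def
proof
  fix x assume x: "x \<in> S"
  have "((\<lambda>y. holder_seminorm \<alpha> S \<phi> * dist y x powr \<alpha>) \<longlongrightarrow> holder_seminorm \<alpha> S \<phi> * dist x x powr \<alpha>) (at x within S)"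
    using assms(2) by (intro tendsto_intros) auto
  then have lim: "((\<lambda>y. holder_seminorm \<alpha> S \<phi> * dist y x powr \<alpha>) \<longlongrightarrow> 0) (at x within S)"
    by simp
  have "((\<lambda>y. \<phi> y - \<phi> x) \<longlongrightarrow> 0) (at x within S)"
    by (rule Lim_null_comparison[OF _ lim])
       (use holder_bound[OF assms(1) _ x] in \<open>auto simp: eventually_at_filter\<close>)
  then show "(\<phi> \<longlongrightarrow> \<phi> x) (at x within S)"
    by (simp add: LIM_zero_iff)
qed

lemma holder_on_bounded:
  assumes "holder_on \<alpha> S \<phi>" "bounded S" "0 < \<alpha>"
  obtains M where "\<And>x. x \<in> S \<Longrightarrow> \<bar>\<phi> x\<bar> \<le> M"
proof (cases "S = {}")
  case False
  then obtain x where x: "x \<in> S" by auto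
  have "\<bar>\<phi> y\<bar> \<le> \<bar>\<phi> x\<bar> + holder_seminorm \<alpha> S \<phi> * diameter S powr \<alpha>" if "y \<in> S" for y
  proof -
    have "\<bar>\<phi> y - \<phi> x\<bar> \<le> holder_seminorm \<alpha> S \<phi> * dist y x powr \<alpha>"
      by (rule holder_bound[OF assms(1) that x])
    also have "\<dots> \<le> holder_seminorm \<alpha> S \<phi> * diameter S powr \<alpha>"
      using diameter_bounded_bound[OF assms(2) that x] assms(3)
      by (intro mult_left_mono powr_mono2 holder_seminorm_nonneg[OF assms(1)]) auto
    finally show ?thesis by linarith
  qed
  then show ?thesis using that by blast
qed (rule that[of 0], simp)

text \<open>Compactness bounds all distances by the diameter, so the real \<open>SUP\<close> in
  \<open>sup_dist_id\<close> is a true upper bound.\<close>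

lemma dist_le_sup_dist_id:
  assumes "compact (UNIV :: 'a::metric_space set)" "x \<in> S"
  shows "dist (h x) (x::'a) \<le> sup_dist_id S h"
  unfolding sup_dist_id_def
proof (rule cSUP_upper[OF assms(2)])
  show "bdd_above ((\<lambda>x. dist (h x) x) ` S)"
    using diameter_bounded_bound[OF compact_imp_bounded[OF assms(1)]]
    by (intro bdd_aboveI[of _ "diameter UNIV"]) auto
qed

lemma abs_le_sup_norm:
  assumes "compact (UNIV :: 'a::metric_space set)" "holder_on \<alpha> UNIV \<xi>" "0 < \<alpha>"
  shows "\<bar>\<xi> (x::'a)\<bar> \<le> sup_norm \<xi>"
proof -
  obtain M where "\<And>x. \<bar>\<xi> x\<bar> \<le> M"
    using holder_on_bounded[OF assms(2) compact_imp_bounded[OF assms(1)] assms(3)] by auto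
  then show ?thesis
    unfolding sup_norm_def by (intro cSUP_upper bdd_aboveI[of _ M]) auto
qed

subsection \<open>Nonwandering sets and periodic orbits\<close>

lemma nonwandering_iff:
  "x \<in> nonwandering f \<longleftrightarrow>
    (\<forall>V. open V \<longrightarrow> x \<in> V \<longrightarrow> (\<exists>n\<ge>1. \<exists>z\<in>V. (f ^^ n) z \<in> V))"
  unfolding nonwandering_def by blast

lemma closed_nonwandering: "closed (nonwandering f)"
proof -
  have "- nonwandering f = \<Union> {V. open V \<and> (\<forall>n\<ge>1. (f ^^ n) ` V \<inter> V = {})}"
    unfolding nonwandering_def by blast
  then show ?thesis
    by (metis (no_types, lifting) closed_open mem_Collect_eq open_Union)
qed

lemma nonwandering_forward_invariant:
  assumes "continuous_on UNIV f" "x \<in> nonwandering f"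
  shows "f x \<in> nonwandering f"
  unfolding nonwandering_iff
proof (intro allI impI)
  fix V assume V: "open V" "f x \<in> V"
  have "open (f -` V)"
    using assms(1) V(1) by (simp add: open_vimage)
  then obtain n z where "n \<ge> 1" "z \<in> f -` V" "(f ^^ n) z \<in> f -` V"
    using assms(2) V(2) unfolding nonwandering_iff by (metis vimageI2)
  then show "\<exists>n\<ge>1. \<exists>z\<in>V. (f ^^ n) z \<in> V"
    by (intro exI[of _ n] conjI bexI[of _ "f z"]) (auto simp: funpow_swap1)
qed

lemma funpow_in_nonwandering:
  assumes "continuous_on UNIV f" "x \<in> nonwandering f"
  shows "(f ^^ n) x \<in> nonwandering f"
  by (induction n) (auto intro: assms nonwandering_forward_invariant)

text \<open>From \<open>y = (f ^^ a) x\<close> the orbit leads back to \<open>x\<close> after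
  \<open>p * a - a\<close> further steps, so every point of the orbit can serve as its base
  point.\<close>

lemma periodic_orbit_rebase:
  assumes "periodic_orbit f P" "y \<in> P"
  obtains p where "p > 0" "(f ^^ p) y = y" "P = range (\<lambda>n. (f ^^ n) y)"
proof -
  obtain x p where p: "p > 0" "(f ^^ p) x = x" "P = range (\<lambda>n. (f ^^ n) x)"
    using assms(1) unfolding periodic_orbit_def by blast
  obtain a where a: "y = (f ^^ a) x"
    using assms(2) p(3) by auto
  have per: "(f ^^ (p * n)) x = x" for n
    by (induction n) (auto simp: funpow_add p(2))
  have 1: "(f ^^ p) y = y"
    unfolding a by (metis add.commute comp_apply funpow_add p(2))
  have "(f ^^ n) x = (f ^^ (n + p * a - a)) y" for n
  proof -
    have "(f ^^ (n + p * a - a)) y = (f ^^ (n + p * a - a + a)) x"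
      unfolding a by (simp add: funpow_add)
    also have "n + p * a - a + a = n + p * a"
      using p(1) by (simp add: trans_le_add2)
    finally show ?thesis
      by (simp add: funpow_add per)
  qed
  moreover have "(f ^^ n) y = (f ^^ (n + a)) x" for n
    unfolding a by (simp add: funpow_add)
  ultimately have "range (\<lambda>n. (f ^^ n) x) = range (\<lambda>n. (f ^^ n) y)"
    by (intro subset_antisym image_subsetI) (metis rangeI)+
  with p(1,3) 1 show ?thesis using that by blast
qed

lemma periodic_orbit_funpow:
  assumes "periodic_orbit f P" "y \<in> P"
  shows "(f ^^ n) y \<in> P"
  using periodic_orbit_rebase[OF assms] by (metis rangeI)

text \<open>The cardinality is the least period \<open>p\<close>: if two of the first
  \<open>p\<close> iterates agreed, at times \<open>i < j\<close>, then \<open>p - j + i\<close>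
  would be a smaller period.\<close>

lemma periodic_orbit_card:
  assumes "periodic_orbit f P" "y \<in> P"
  shows "bij_betw (\<lambda>m. (f ^^ m) y) {..<card P} P" "(f ^^ card P) y = y" "0 < card P"
proof -
  obtain p0 where p0: "p0 > 0" "(f ^^ p0) y = y" "P = range (\<lambda>n. (f ^^ n) y)"
    using periodic_orbit_rebase[OF assms] by blast
  define p where "p = (LEAST p. 0 < p \<and> (f ^^ p) y = y)"
  have p: "0 < p \<and> (f ^^ p) y = y"
    unfolding p_def by (rule LeastI[of _ p0]) (use p0 in auto)
  have least: "p \<le> k" if "0 < k" "(f ^^ k) y = y" for k
    unfolding p_def by (rule Least_le) (use that in auto)
  have inj: "inj_on (\<lambda>m. (f ^^ m) y) {..<p}"
  proof (rule linorder_inj_onI)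
    fix i j assume ij: "i < j" "i \<in> {..<p}" "j \<in> {..<p}"
    show "(f ^^ i) y \<noteq> (f ^^ j) y"
    proof
      assume "(f ^^ i) y = (f ^^ j) y"
      then have "(f ^^ (p - j + i)) y = (f ^^ (p - j + j)) y"
        by (simp add: funpow_add)
      then have "(f ^^ (p - j + i)) y = y"
        using ij p by simp
      then show False
        using least[of "p - j + i"] ij by auto
    qed
  qed auto
  have "(f ^^ n) y = (f ^^ (n mod p)) y" for n
    using p by (simp add: funpow_mod_eq)
  then have img: "P = (\<lambda>m. (f ^^ m) y) ` {..<p}"
    unfolding p0(3) using p by (auto simp: image_iff) (metis lessThan_iff mod_less_divisor)
  then have "card P = p"
    using card_image[OF inj] by simp
  then show "bij_betw (\<lambda>m. (f ^^ m) y) {..<card P} P" "(f ^^ card P) y = y" "0 < card P"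
    using inj img p by (auto simp: bij_betw_def)
qed

lemma periodic_orbit_nonempty: "periodic_orbit f P \<Longrightarrow> P \<noteq> {}"
  unfolding periodic_orbit_def by auto

lemma periodic_orbit_finite:
  assumes "periodic_orbit f P"
  shows "finite P"
proof -
  obtain y where "y \<in> P"
    using periodic_orbit_nonempty[OF assms] by auto
  then have "0 < card P"
    by (rule periodic_orbit_card(3)[OF assms])
  then show ?thesis
    by (rule card_ge_0_finite)
qed

lemma periodic_orbit_bij:
  assumes "periodic_orbit f P"
  shows "bij_betw f P P"
proof -
  have sub: "f ` P \<subseteq> P"
    using periodic_orbit_funpow[OF assms, of _ 1] by auto
  have "P \<subseteq> f ` P"
  proof
    fix y assume y: "y \<in> P"
    have "f ((f ^^ (card P - 1)) y) = (f ^^ Suc (card P - 1)) y" by simp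
    also have "\<dots> = y"
      using periodic_orbit_card(2,3)[OF assms y] by simp
    finally show "y \<in> f ` P"
      using periodic_orbit_funpow[OF assms y] by (metis imageI)
  qed
  with sub have "f ` P = P" by auto
  then show ?thesis
    using eq_card_imp_inj_on[OF periodic_orbit_finite[OF assms], of f] by (simp add: bij_betw_def)
qed

lemma periodic_orbit_nonwandering:
  assumes "periodic_orbit f P"
  shows "P \<subseteq> nonwandering f"
proof
  fix y assume y: "y \<in> P"
  then show "y \<in> nonwandering f"
    unfolding nonwandering_iff
    using periodic_orbit_card(2,3)[OF assms y] by (metis One_nat_def Suc_leI)
qed

text \<open>The semiconjugacy holds on the nonwandering set, which contains \<open>P\<close>. The
  image may have a smaller period, as \<open>h\<close> need not be injective;
  \<open>periodic_orbit\<close> asks for some period only.\<close>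

lemma periodic_orbit_image:
  assumes "periodic_orbit f P" "continuous_on UNIV f"
    and "\<And>x. x \<in> nonwandering f \<Longrightarrow> h (f x) = g (h x)"
  shows "periodic_orbit g (h ` P)"
proof -
  obtain x p where p: "p > 0" "(f ^^ p) x = x" "P = range (\<lambda>n. (f ^^ n) x)"
    using assms(1) unfolding periodic_orbit_def by blast
  have "x \<in> P" unfolding p(3) by (metis funpow_0 rangeI)
  then have x: "x \<in> nonwandering f"
    using periodic_orbit_nonwandering[OF assms(1)] by auto
  have "h ((f ^^ n) x) = (g ^^ n) (h x)" for n
    by (induction n) (auto simp: assms(3) funpow_in_nonwandering[OF assms(2) x])
  then have "(g ^^ p) (h x) = h x" "h ` P = range (\<lambda>n. (g ^^ n) (h x))"
    using p(2) unfolding p(3) image_image by (metis, simp)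
  then show ?thesis
    unfolding periodic_orbit_def using p(1) by blast
qed

lemma sum_lessThan_add:
  fixes F :: "nat \<Rightarrow> 'a::comm_monoid_add"
  shows "(\<Sum>m<p + k. F m) = (\<Sum>m<p. F m) + (\<Sum>m<k. F (m + p))"
  by (induction k) (simp_all add: ac_simps)

text \<open>Complete periods contribute nothing because \<open>sum F P = 0\<close>. Only an
  incomplete period with fewer than \<open>card P\<close> terms is left, so the bound does not
  depend on \<open>n\<close>.\<close>

lemma periodic_orbit_sum_le:
  fixes F :: "'a \<Rightarrow> real" and e :: real
  assumes P: "periodic_orbit g P" and "sum F P = 0" "\<And>z. z \<in> P \<Longrightarrow> F z \<le> e" "0 \<le> e" "y \<in> P"
  shows "(\<Sum>m<n. F ((g ^^ m) y)) \<le> card P * e"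
proof (induction n rule: less_induct)
  case (less n)
  show ?case
  proof (cases "n < card P")
    case True
    have "(\<Sum>m<n. F ((g ^^ m) y)) \<le> (\<Sum>m<n. e :: real)"
      by (intro sum_mono assms periodic_orbit_funpow[OF P])
    also have "\<dots> \<le> card P * e"
      using True assms(4) by (simp add: mult_right_mono)
    finally show ?thesis .
  next
    case False
    have "(\<Sum>m<n. F ((g ^^ m) y)) = (\<Sum>m<card P. F ((g ^^ m) y)) + (\<Sum>m<n - card P. F ((g ^^ (m + card P)) y))"
      using False sum_lessThan_add[of "\<lambda>m. F ((g ^^ m) y)" "card P" "n - card P"] by simp
    also have "(\<Sum>m<card P. F ((g ^^ m) y)) = 0"
      using sum.reindex_bij_betw[OF periodic_orbit_card(1)[OF P \<open>y \<in> P\<close>], of F] assms(2) by simp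
    also have "(\<Sum>m<n - card P. F ((g ^^ (m + card P)) y)) = (\<Sum>m<n - card P. F ((g ^^ m) y))"
      by (simp add: funpow_add periodic_orbit_card(2)[OF P \<open>y \<in> P\<close>])
    also have "0 + \<dots> \<le> card P * e"
      using less[of "n - card P"] False periodic_orbit_card(3)[OF P \<open>y \<in> P\<close>] by simp
    finally show ?thesis .
  qed
qed

subsection \<open>Birkhoff sums\<close>

lemma sum_geometric_inj_le:
  fixes q :: real
  assumes "0 < q" "q < 1" "finite A" "inj_on e A"
  shows "(\<Sum>m\<in>A. q ^ e m) \<le> 1 / (1 - q)"
proof -
  have "(\<Sum>m\<in>A. q ^ e m) = (\<Sum>i\<in>e ` A. q ^ i)"
    by (simp add: sum.reindex[OF assms(4)])
  also have "\<dots> \<le> (\<Sum>i. q ^ i)"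
    using assms by (intro sum_le_suminf summable_geometric) auto
  also have "\<dots> = 1 / (1 - q)"
    using assms by (intro suminf_geometric) auto
  finally show ?thesis .
qed

text \<open>Each term is one of \<open>q ^ m\<close> and \<open>q ^ (l - 1 - m)\<close>, hence at
  most their sum, and both families add up to at most a full geometric series. The bound is uniform
  in the length \<open>l\<close>.\<close>

lemma sum_two_sided_geometric_le:
  fixes q :: real
  assumes "0 < q" "q < 1"
  shows "(\<Sum>m<l. q ^ min m (l - 1 - m)) \<le> 2 / (1 - q)"
proof -
  have "(\<Sum>m<l. q ^ min m (l - 1 - m)) \<le> (\<Sum>m<l. q ^ m + q ^ (l - 1 - m))"
    using assms by (intro sum_mono) (auto simp: min_def)
  also have "\<dots> = (\<Sum>m<l. q ^ m) + (\<Sum>m<l. q ^ (l - 1 - m))"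
    by (rule sum.distrib)
  also have "\<dots> \<le> 1 / (1 - q) + 1 / (1 - q)"
    by (intro add_mono sum_geometric_inj_le assms) (auto intro!: inj_onI)
  finally show ?thesis by simp
qed

text \<open>Here a and b are Birkhoff summands along an orbit and along the periodic orbit it shadows, vx and vy the
  values of the transfer function.  Away from the ends of the run the two orbits are compared directly;
  each of the k steps at either end costs at most e.\<close>
lemma shadowing_run_sum_le:
  fixes a b vx vy :: "nat \<Rightarrow> real" and e pe D q w :: real
  assumes "0 \<le> e" and step: "\<And>m. m \<le> n \<Longrightarrow> a m + vx m - vx (Suc m) \<le> e"
    and "0 \<le> pe" and per: "\<And>j l. (\<Sum>m<l. b (m + j) + vy (m + j) - vy (Suc (m + j))) \<le> pe"
    and "0 \<le> D" and q: "0 < q" "q < 1"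
    and diff: "\<And>m. k \<le> m \<Longrightarrow> m + k \<le> n \<Longrightarrow> a m - b m \<le> D * q ^ (min m (n - m) - k)"
    and "0 \<le> w"
    and close: "\<And>m. k \<le> m \<Longrightarrow> m + k \<le> Suc n \<Longrightarrow> 2 * k \<le> n \<Longrightarrow> \<bar>vx m - vy m\<bar> \<le> w"
  shows "(\<Sum>m<Suc n. a m + vx m - vx (Suc m)) \<le> 2 * k * e + pe + D * (2 / (1 - q)) + 2 * w"
proof (cases "2 * k \<le> n")
  \<comment> \<open>Here the run has at most \<open>2 * k\<close> steps, so there is no middle part
    and the bound \<open>e\<close> per step suffices.\<close>
  case False
  have "(\<Sum>m<Suc n. a m + vx m - vx (Suc m)) \<le> (\<Sum>m<Suc n. e)"
    by (intro sum_mono step) auto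
  also have "\<dots> = real (Suc n) * e" by simp
  also have "\<dots> \<le> real (2 * k) * e"
    using False \<open>0 \<le> e\<close> by (intro mult_right_mono) linarith+
  also have "\<dots> \<le> 2 * k * e + pe + D * (2 / (1 - q)) + 2 * w"
    using assms by simp
  finally show ?thesis by simp
next
  case True
  define l where "l = Suc n - 2 * k"
  define F where "F m = a m + vx m - vx (Suc m)" for m
  have n: "Suc n = k + (l + k)"
    using True by (simp add: l_def)
  have "(\<Sum>m<Suc n. F m) = (\<Sum>m<k. F m) + (\<Sum>m<l. F (m + k)) + (\<Sum>m<k. F (m + l + k))"
    unfolding n sum_lessThan_add[of F] sum_lessThan_add[of "\<lambda>m. F (m + k)"] by simp
  moreover have "(\<Sum>m<k. F m) \<le> (\<Sum>m<k. e)" "(\<Sum>m<k. F (m + l + k)) \<le> (\<Sum>m<k. e)"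
    unfolding F_def by (intro sum_mono step; use n in auto)+
  moreover have "(\<Sum>m<l. F (m + k)) \<le> pe + D * (2 / (1 - q)) + 2 * w"
  proof -
    have "(\<Sum>m<l. F (m + k)) =
        (\<Sum>m<l. a (m + k) - b (m + k)) + (\<Sum>m<l. b (m + k) + vy (m + k) - vy (Suc (m + k)))
        + (\<Sum>m<l. (vx (m + k) - vy (m + k)) - (vx (Suc m + k) - vy (Suc m + k)))"
      unfolding F_def sum.distrib[symmetric] by (intro sum.cong) auto
    \<comment> \<open>The differences of the transfer values telescope, so their error is paid twice
      in all and not once per step.\<close>
    also have "(\<Sum>m<l. (vx (m + k) - vy (m + k)) - (vx (Suc m + k) - vy (Suc m + k)))
        = (vx (0 + k) - vy (0 + k)) - (vx (l + k) - vy (l + k))"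
      by (rule sum_lessThan_telescope')
    finally have split: "(\<Sum>m<l. F (m + k)) = (\<Sum>m<l. a (m + k) - b (m + k))
        + (\<Sum>m<l. b (m + k) + vy (m + k) - vy (Suc (m + k)))
        + ((vx (0 + k) - vy (0 + k)) - (vx (l + k) - vy (l + k)))" .
    have bdry: "(vx (0 + k) - vy (0 + k)) - (vx (l + k) - vy (l + k)) \<le> 2 * w"
      using close[of k] close[of "l + k"] True n by (simp add: abs_le_iff)
    have "(\<Sum>m<l. a (m + k) - b (m + k)) \<le> (\<Sum>m<l. D * q ^ min m (l - 1 - m))"
    proof (rule sum_mono)
      fix m assume "m \<in> {..<l}"
      then have "min (m + k) (n - (m + k)) - k = min m (l - 1 - m)" "m + k + k \<le> n"
        using n by auto
      then show "a (m + k) - b (m + k) \<le> D * q ^ min m (l - 1 - m)"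
        using diff[of "m + k"] by simp
    qed
    also have "\<dots> \<le> D * (2 / (1 - q))"
      unfolding sum_distrib_left[symmetric]
      by (intro mult_left_mono sum_two_sided_geometric_le q \<open>0 \<le> D\<close>)
    finally show ?thesis using per[of k l] split bdry by linarith
  qed
  ultimately show ?thesis unfolding F_def by simp
qed

text \<open>The exponent \<open>k\<close> is about the logarithm of \<open>T / d\<close> to base
  \<kappa>, which every positive power of \<open>1 / d\<close> outgrows; hence \<open>B\<close> can
  be chosen uniformly in \<open>d\<close>. This lets a penalty of order
  \<open>d powr (\<alpha> / 2)\<close> dominate \<open>k\<close> steps costing
  \<open>d powr \<alpha>\<close> each.\<close>

lemma ex_exponent_with_small_log:
  fixes T \<kappa> s :: real
  assumes "0 < T" "1 < \<kappa>" "0 < s"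
  obtains B where "0 \<le> B"
    "\<And>d. 0 < d \<Longrightarrow> d \<le> 1 \<Longrightarrow> \<exists>k::nat. T * \<kappa> powr (- real k) \<le> d \<and> real k * d powr s \<le> B"
proof
  define B where "B = 1 + T powr s / (s * ln \<kappa>)"
  have lnk: "0 < ln \<kappa>" using assms by simp
  show "0 \<le> B" unfolding B_def using assms by simp
  fix d :: real assume d: "0 < d" "d \<le> 1"
  show "\<exists>k::nat. T * \<kappa> powr (- real k) \<le> d \<and> real k * d powr s \<le> B"
  proof (cases "T \<le> d")
    case True
    then show ?thesis using \<open>0 \<le> B\<close> assms by (intro exI[of _ 0]) simp
  next
    case False
    define k where "k = nat \<lceil>log \<kappa> (T / d)\<rceil>"
    have Td: "1 \<le> T / d" using False d by simp
    have l0: "0 \<le> log \<kappa> (T / d)" using Td assms by simp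
    have k1: "log \<kappa> (T / d) \<le> real k" and k2: "real k \<le> log \<kappa> (T / d) + 1"
      unfolding k_def using l0 by linarith+
    have "T / d = \<kappa> powr log \<kappa> (T / d)"
      using assms Td by simp
    also have "\<dots> \<le> \<kappa> powr real k"
      using k1 assms by (intro powr_mono) auto
    finally have 1: "T * \<kappa> powr (- real k) \<le> d"
      using d assms by (simp add: powr_minus divide_simps mult.commute)
    \<comment> \<open>The inequality \<open>ln t \<le> t powr s / s\<close> for
      \<open>t \<ge> 1\<close> turns the logarithm into a power whose denominator cancels against
      \<open>d powr s\<close>.\<close>
    have "log \<kappa> (T / d) \<le> (T / d) powr s / s / ln \<kappa>"
      unfolding log_def using ln_powr_bound[OF Td assms(3)] lnk by (intro divide_right_mono) auto
    then have "real k * d powr s \<le> ((T / d) powr s / s / ln \<kappa> + 1) * d powr s"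
      using k2 by (intro mult_right_mono) auto
    also have "\<dots> = T powr s / (s * ln \<kappa>) + d powr s"
      using assms d by (simp add: powr_divide field_simps)
    also have "\<dots> \<le> B"
      unfolding B_def using d assms powr_le_one_le[of d s] by (simp add: powr_le1)
    finally show ?thesis using 1 by blast
  qed
qed

text \<open>Every visit to B pays for the good run before it and still gains c, because E is at most c.\<close>
lemma birkhoff_sum_le_count:
  fixes \<psi> :: "'a \<Rightarrow> real" and c E :: real
  assumes inv: "\<And>x. x \<in> S \<Longrightarrow> g x \<in> S"
    and run: "\<And>x n. x \<in> S \<Longrightarrow> (\<And>m. m < n \<Longrightarrow> (g ^^ m) x \<notin> B) \<Longrightarrow> (\<Sum>m<n. \<psi> ((g ^^ m) x)) \<le> E"
    and bad: "\<And>x. x \<in> S \<Longrightarrow> x \<in> B \<Longrightarrow> \<psi> x \<le> - 2 * c"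
    and "E \<le> c" and "x \<in> S"
  shows "(\<Sum>m<N. \<psi> ((g ^^ m) x)) \<le> E - c * (\<Sum>m<N. indicator B ((g ^^ m) x))"
  using \<open>x \<in> S\<close>
proof (induction N arbitrary: x rule: less_induct)
  case (less N)
  have S: "(g ^^ m) x \<in> S" for m
    by (induction m) (auto intro: inv less.prems)
  show ?case
  proof (cases "\<forall>m<N. (g ^^ m) x \<notin> B")
    case True
    then show ?thesis
      using run[of x N] less.prems by simp
  next
    case False
    \<comment> \<open>Cut at the first visit: the run before it costs at most \<open>E\<close>, the
      visit gives at most \<open>- 2 * c\<close>, and the induction hypothesis treats the orbit of
      \<open>z\<close> after it, with its own allowance \<open>E\<close>.\<close>
    define b where "b = (LEAST m. (g ^^ m) x \<in> B)"
    obtain m0 where m0: "m0 < N" "(g ^^ m0) x \<in> B" using False by auto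
    have b: "(g ^^ b) x \<in> B" unfolding b_def by (rule LeastI[of _ m0]) (rule m0)
    have bN: "b < N" using m0 Least_le[of "\<lambda>m. (g ^^ m) x \<in> B" m0] unfolding b_def by simp
    have nb: "(g ^^ m) x \<notin> B" if "m < b" for m
      using not_less_Least that unfolding b_def by blast
    define M where "M = N - Suc b"
    have N: "N = Suc b + M" using bN by (simp add: M_def)
    define z where "z = (g ^^ Suc b) x"
    have sh: "(g ^^ (m + Suc b)) x = (g ^^ m) z" for m
      unfolding z_def by (simp only: funpow_add comp_apply)
    have "(\<Sum>m<N. \<psi> ((g ^^ m) x)) = (\<Sum>m<b. \<psi> ((g ^^ m) x)) + \<psi> ((g ^^ b) x) + (\<Sum>m<M. \<psi> ((g ^^ m) z))"
      unfolding N sum_lessThan_add sh by simp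
    moreover have "(\<Sum>m<N. indicator B ((g ^^ m) x)) =
        (\<Sum>m<b. indicator B ((g ^^ m) x)) + indicator B ((g ^^ b) x) + (\<Sum>m<M. indicator B ((g ^^ m) z) :: real)"
      unfolding N sum_lessThan_add sh by simp
    moreover have "(\<Sum>m<b. indicator B ((g ^^ m) x) :: real) = 0"
      using nb by simp
    moreover have "(\<Sum>m<b. \<psi> ((g ^^ m) x)) \<le> E"
      using run[OF less.prems] nb by blast
    moreover have "\<psi> ((g ^^ b) x) \<le> - 2 * c"
      by (rule bad[OF S b])
    moreover have "(\<Sum>m<M. \<psi> ((g ^^ m) z)) \<le> E - c * (\<Sum>m<M. indicator B ((g ^^ m) z))"
      by (rule less.IH) (use N S in \<open>auto simp: z_def inv\<close>)
    ultimately show ?thesis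
      using b \<open>E \<le> c\<close> by (simp add: distrib_left)
  qed
qed

subsection \<open>Invariant measures\<close>

lemma invariant_measuresD:
  assumes "\<mu> \<in> invariant_measures g"
  shows "sets \<mu> = sets borel" "space \<mu> = UNIV" "prob_space \<mu>" "distr \<mu> borel g = \<mu>"
  using assms sets_eq_imp_space_eq[of \<mu> borel] by (auto simp: invariant_measures_def)

lemma measurable_funpow_continuous:
  fixes g :: "'a::topological_space \<Rightarrow> 'a"
  assumes "continuous_on UNIV g"
  shows "g ^^ n \<in> borel_measurable borel"
proof (induction n)
  case (Suc n)
  have "g \<in> borel_measurable borel"
    by (rule borel_measurable_continuous_onI[OF assms])
  then show ?case
    using measurable_comp[OF Suc, of g borel] by simp
qed (simp add: id_def)

lemma distr_funpow_invariant:
  assumes "\<mu> \<in> invariant_measures g" "continuous_on UNIV g"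
  shows "distr \<mu> borel (g ^^ n) = \<mu>"
proof (induction n)
  case 0
  have "distr \<mu> borel (\<lambda>x. x) = \<mu>"
    by (rule distr_id2) (simp add: invariant_measuresD[OF assms(1)])
  then show ?case by (simp add: id_def)
next
  case (Suc n)
  note D = invariant_measuresD[OF assms(1)]
  have [measurable_cong]: "sets \<mu> = sets borel" by (rule D)
  have "distr \<mu> borel (g ^^ Suc n) = distr (distr \<mu> borel (g ^^ n)) borel g"
    using measurable_funpow_continuous[OF assms(2), of n] borel_measurable_continuous_onI[OF assms(2)]
    by (subst distr_distr) (auto simp: comp_def measurable_cong_sets[OF D(1) refl])
  also have "\<dots> = \<mu>" by (simp only: Suc D)
  finally show ?case .
qed

lemma AE_funpow_invariant:
  assumes "\<mu> \<in> invariant_measures g" "continuous_on UNIV g" "S \<in> sets borel"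
    and "AE x in \<mu>. x \<in> S"
  shows "AE x in \<mu>. (g ^^ n) x \<in> S"
proof -
  have "AE x in distr \<mu> borel (g ^^ n). x \<in> S"
    by (subst distr_funpow_invariant[OF assms(1,2)]) (rule assms(4))
  moreover have "g ^^ n \<in> measurable \<mu> borel"
    using measurable_funpow_continuous[OF assms(2), of n]
    by (simp add: measurable_cong_sets[OF invariant_measuresD(1)[OF assms(1)] refl])
  ultimately show ?thesis
    by (rule AE_distrD[rotated])
qed

lemma integral_funpow_invariant:
  fixes \<phi> :: "'a::topological_space \<Rightarrow> real"
  assumes "\<mu> \<in> invariant_measures g" "continuous_on UNIV g" "\<phi> \<in> borel_measurable borel"
  shows "(\<integral>x. \<phi> ((g ^^ n) x) \<partial>\<mu>) = (\<integral>x. \<phi> x \<partial>\<mu>)"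
proof -
  have "(\<integral>x. \<phi> x \<partial>distr \<mu> borel (g ^^ n)) = (\<integral>x. \<phi> ((g ^^ n) x) \<partial>\<mu>)"
    using measurable_funpow_continuous[OF assms(2), of n] assms(3)
    by (intro integral_distr) (auto simp: measurable_cong_sets[OF invariant_measuresD(1)[OF assms(1)] refl])
  then show ?thesis by (simp add: distr_funpow_invariant[OF assms(1,2)])
qed

text \<open>The preimages of \<open>V\<close> under the iterates have equal measure by invariance
  and are pairwise disjoint, since a common point would yield a return to \<open>V\<close>. In a
  probability space their common measure must be 0.\<close>

lemma wandering_null:
  assumes "\<mu> \<in> invariant_measures g" "continuous_on UNIV g" "open V"
    and wand: "\<forall>n\<ge>1. (g ^^ n) ` V \<inter> V = {}"
  shows "V \<in> null_sets \<mu>"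
proof -
  note D = invariant_measuresD[OF assms(1)]
  interpret prob_space \<mu> by (rule D)
  define A where "A n = (g ^^ n) -` V" for n
  have meas: "A n \<in> sets \<mu>" "measure \<mu> (A n) = measure \<mu> V" for n
  proof -
    have m: "g ^^ n \<in> measurable \<mu> borel"
      using measurable_funpow_continuous[OF assms(2), of n] by (simp add: measurable_cong_sets[OF D(1) refl])
    show "A n \<in> sets \<mu>"
      using measurable_sets[OF m, of V] assms(3) by (simp add: A_def D)
    have "measure (distr \<mu> borel (g ^^ n)) V = measure \<mu> (A n)"
      using measure_distr[OF m, of V] assms(3) by (simp add: A_def D)
    then show "measure \<mu> (A n) = measure \<mu> V"
      by (simp add: distr_funpow_invariant[OF assms(1,2)])
  qed
  have disj: "A m \<inter> A n = {}" if "m < n" for m n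
  proof -
    have "(g ^^ n) x \<notin> V" if "(g ^^ m) x \<in> V" for x
    proof
      assume "(g ^^ n) x \<in> V"
      moreover have "(g ^^ n) x = (g ^^ (n - m)) ((g ^^ m) x)"
        using \<open>m < n\<close> by (metis add_diff_cancel_right' comp_apply funpow_add le_add_diff_inverse2 less_imp_le)
      moreover have "(g ^^ (n - m)) ` V \<inter> V = {}"
        using wand \<open>m < n\<close> by simp
      ultimately show False
        using that by auto
    qed
    then show ?thesis by (auto simp: A_def)
  qed
  have "disjoint_family A"
    unfolding disjoint_family_on_def using disj by (metis Int_commute linorder_neqE_nat)
  then have "(\<lambda>n. measure \<mu> (A n)) sums measure \<mu> (\<Union>n. A n)"
    using meas by (intro finite_measure_UNION) auto
  then have "measure \<mu> V = 0"
    using meas(2) by (auto dest!: sums_summable simp: summable_const_iff)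
  then show ?thesis
    using assms(3) by (auto simp: null_sets_def emeasure_eq_measure D)
qed

text \<open>The wandering open sets may be uncountably many, so compactness is used: finitely many
  of them cover a closed subset of the complement, and the complement is the countable union of the
  closed sets \<open>K n\<close>.\<close>

lemma AE_nonwandering:
  fixes g :: "'a::metric_space \<Rightarrow> 'a"
  assumes "compact (UNIV :: 'a set)" "\<mu> \<in> invariant_measures g" "continuous_on UNIV g"
  shows "AE x in \<mu>. x \<in> nonwandering g"
proof -
  note D = invariant_measuresD[OF assms(2)]
  interpret prob_space \<mu> by (rule D)
  have null: "K \<in> null_sets \<mu>" if K: "closed K" "K \<subseteq> - nonwandering g" for K
  proof -
    have "compact K"
      using compact_Int_closed[OF assms(1) K(1)] by simp
    let ?C = "{V. open V \<and> (\<forall>n\<ge>1. (g ^^ n) ` V \<inter> V = {})}"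
    have "K \<subseteq> \<Union> ?C"
      using K(2) unfolding nonwandering_def by blast
    then obtain C' where C': "C' \<subseteq> ?C" "finite C'" "K \<subseteq> \<Union> C'"
      using compactE[OF \<open>compact K\<close>, of ?C] by blast
    have "\<Union> C' \<in> null_sets \<mu>"
      using C'(1,2) wandering_null[OF assms(2,3)] by (intro null_sets.finite_Union) auto
    then show ?thesis
      by (rule null_sets_subset) (use C' K(1) in \<open>auto simp: D\<close>)
  qed
  \<comment> \<open>The value of \<open>infdist\<close> to the empty set is 0 by convention, so this
    case is excluded first: the whole space would be null.\<close>
  have ne: "nonwandering g \<noteq> {}"
  proof
    assume "nonwandering g = {}"
    then have "UNIV \<in> null_sets \<mu>" by (intro null) auto
    then show False
      using emeasure_space_1 by (simp add: null_sets_def D)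
  qed
  define K where "K n = {x. infdist x (nonwandering g) \<ge> 1 / Suc n}" for n :: nat
  have "AE x in \<mu>. \<forall>n. x \<notin> K n"
  proof (subst AE_all_countable, intro allI AE_not_in null)
    fix n
    show "closed (K n)"
      unfolding K_def by (intro closed_Collect_le continuous_intros)
    show "K n \<subseteq> - nonwandering g"
      by (auto simp: K_def)
  qed
  moreover have "x \<in> nonwandering g" if "\<forall>n. x \<notin> K n" for x
  proof -
    have "infdist x (nonwandering g) < 1 / Suc n" for n
      using that by (simp add: K_def not_le)
    then have "infdist x (nonwandering g) \<le> 0"
      by (meson not_le nat_approx_posE less_asym)
    then show ?thesis
      using in_closed_iff_infdist_zero[OF closed_nonwandering ne] infdist_nonneg
      by (metis order_antisym)
  qed
  ultimately show ?thesis by (metis (mono_tags, lifting) eventually_mono)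
qed

text \<open>Invariance gives a point at most the mass of its iterates; going round the cycle, all
  points of \<open>P\<close> have equal mass. Both measures are therefore uniform on
  \<open>P\<close>.\<close>

lemma invariant_measure_on_orbit_unique:
  fixes g :: "'a::metric_space \<Rightarrow> 'a"
  assumes P: "periodic_orbit g P" and \<mu>: "\<mu> \<in> invariant_measures g" "AE x in \<mu>. x \<in> P"
    and \<nu>: "\<nu> \<in> invariant_measures g" "AE x in \<nu>. x \<in> P" and g: "continuous_on UNIV g"
  shows "\<mu> = \<nu>"
proof -
  have fin: "finite P" by (rule periodic_orbit_finite[OF P])
  have key: "measure \<mu> A = card (A \<inter> P) / card P"
    if \<mu>: "\<mu> \<in> invariant_measures g" "AE x in \<mu>. x \<in> P" and A: "A \<in> sets borel" for \<mu> A
  proof -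
    note D = invariant_measuresD[OF \<mu>(1)]
    interpret prob_space \<mu> by (rule D)
    have fs: "F \<in> sets \<mu>" if "finite F" for F
      using that by (simp add: D borel_closed finite_imp_closed)
    have le: "measure \<mu> {x} \<le> measure \<mu> {(g ^^ n) x}" for x n
    proof -
      have m: "g ^^ n \<in> measurable \<mu> borel"
        using measurable_funpow_continuous[OF g, of n] by (simp add: measurable_cong_sets[OF D(1) refl])
      have "measure \<mu> {(g ^^ n) x} = measure (distr \<mu> borel (g ^^ n)) {(g ^^ n) x}"
        by (simp add: distr_funpow_invariant[OF \<mu>(1) g])
      also have "\<dots> = measure \<mu> ((g ^^ n) -` {(g ^^ n) x} \<inter> space \<mu>)"
        by (rule measure_distr[OF m]) simp
      also have "\<dots> \<ge> measure \<mu> {x}"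
        using measurable_sets[OF m, of "{(g ^^ n) x}"] by (intro finite_measure_mono) (auto simp: D)
      finally show ?thesis .
    qed
    have le': "measure \<mu> {x} \<le> measure \<mu> {y}" if xy: "x \<in> P" "y \<in> P" for x y
    proof -
      obtain p where "P = range (\<lambda>n. (g ^^ n) x)"
        using periodic_orbit_rebase[OF P xy(1)] by blast
      then obtain n where "y = (g ^^ n) x"
        using xy(2) by auto
      then show ?thesis using le by simp
    qed
    have eq: "measure \<mu> {x} = measure \<mu> {y}" if "x \<in> P" "y \<in> P" for x y
      using le'[OF that] le'[OF that(2,1)] by simp
    obtain y where y: "y \<in> P" using periodic_orbit_nonempty[OF P] by auto
    have sum: "measure \<mu> F = card F * measure \<mu> {y}" if "F \<subseteq> P" for F
    proof -
      have "measure \<mu> F = (\<Sum>x\<in>F. measure \<mu> {x})"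
        using fin that by (intro finite_measure_eq_sum_singleton) (auto simp: fs finite_subset)
      also have "\<dots> = (\<Sum>x\<in>F. measure \<mu> {y})"
        by (intro sum.cong refl eq) (use y that in auto)
      finally show ?thesis by simp
    qed
    have "measure \<mu> P = 1"
      using \<mu>(2) fs[OF fin] by (simp add: prob_eq_1)
    then have my: "measure \<mu> {y} = 1 / card P"
      using sum[OF order_refl] periodic_orbit_card(3)[OF P y] by (simp add: field_simps)
    have "measure \<mu> A = measure \<mu> (A \<inter> P)"
      using \<mu>(2) A fs[OF fin] by (intro finite_measure_eq_AE) (auto simp: D)
    also have "\<dots> = card (A \<inter> P) / card P"
      using sum[of "A \<inter> P"] my by simp
    finally show ?thesis .
  qed
  note D = invariant_measuresD[OF \<mu>(1)] invariant_measuresD[OF \<nu>(1)]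
  interpret M: prob_space \<mu> by (rule D)
  interpret N: prob_space \<nu> by (rule D)
  show ?thesis
  proof (rule measure_eqI)
    show "sets \<mu> = sets \<nu>" by (simp add: D)
    fix A assume "A \<in> sets \<mu>"
    then have "A \<in> sets borel" by (simp add: D)
    then show "emeasure \<mu> A = emeasure \<nu> A"
      by (simp add: M.emeasure_eq_measure N.emeasure_eq_measure key[OF \<mu>] key[OF \<nu>])
  qed
qed

text \<open>For \<open>measure_of\<close> to return the given set function, that function must be a
  measure. Agreement with the uniform distribution on \<open>P\<close> supplies this and gives
  access to the rules for \<open>pmf\<close>.\<close>

lemma orbit_measure_eq_distr:
  fixes P :: "'a::t1_space set"
  assumes "finite P" "P \<noteq> {}"
  shows "orbit_measure P = distr (measure_pmf (pmf_of_set P)) borel (\<lambda>x. x)"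
proof -
  let ?M = "distr (measure_pmf (pmf_of_set P)) borel (\<lambda>x. x)"
  have "orbit_measure P = measure_of (space ?M) (sets ?M) (emeasure ?M)"
    unfolding orbit_measure_def space_distr sets_distr space_borel
  proof (rule measure_of_eq)
    fix A :: "'a set" assume "A \<in> sigma_sets UNIV (sets borel)"
    then have A: "A \<in> sets borel"
      using sets.sigma_sets_eq[of "borel :: 'a measure"] by simp
    have "emeasure ?M A = ennreal (real (card (P \<inter> A)) / real (card P))"
      using assms A by (simp add: emeasure_distr emeasure_pmf_of_set)
    moreover have "(\<Sum>x\<in>P. emeasure (return borel x) A) = ennreal (real (card (P \<inter> A)))"
    proof -
      have "(\<Sum>x\<in>P. emeasure (return borel x) A) = (\<Sum>x\<in>P. ennreal (indicator A x))"
        using A by (simp add: ennreal_indicator)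
      also have "\<dots> = ennreal (\<Sum>x\<in>P. indicator A x)"
        by (rule sum_ennreal) simp
      also have "(\<Sum>x\<in>P. indicator A x) = real (card (P \<inter> A))"
        using assms(1) by (simp add: indicator_def sum.If_cases Int_def)
      finally show ?thesis .
    qed
    ultimately show "ennreal (1 / real (card P)) * (\<Sum>x\<in>P. emeasure (return borel x) A) = emeasure ?M A"
      by (simp add: ennreal_mult'[symmetric])
  qed (simp add: sets.space_closed[of "borel :: 'a measure", simplified])
  then show ?thesis by (simp only: measure_of_of_measure)
qed

lemma integral_orbit_measure:
  fixes \<phi> :: "'a::t1_space \<Rightarrow> real"
  assumes "finite P" "P \<noteq> {}" "\<phi> \<in> borel_measurable borel"
  shows "integral\<^sup>L (orbit_measure P) \<phi> = sum \<phi> P / card P"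
proof -
  have "integral\<^sup>L (orbit_measure P) \<phi> = integral\<^sup>L (measure_pmf (pmf_of_set P)) \<phi>"
    unfolding orbit_measure_eq_distr[OF assms(1,2)]
    by (rule integral_distr) (use assms(3) in auto)
  then show ?thesis
    by (simp add: integral_pmf_of_set[OF assms(2,1)])
qed

lemma orbit_measure_invariant:
  fixes g :: "'a::metric_space \<Rightarrow> 'a"
  assumes P: "periodic_orbit g P" and g: "continuous_on UNIV g"
  shows "orbit_measure P \<in> invariant_measures g" "AE x in orbit_measure P. x \<in> P"
proof -
  note fin = periodic_orbit_finite[OF P] and ne = periodic_orbit_nonempty[OF P]
  note eq = orbit_measure_eq_distr[OF fin ne]
  have gm: "g \<in> borel_measurable borel"
    by (rule borel_measurable_continuous_onI[OF g])
  have "distr (orbit_measure P) borel g = distr (measure_pmf (pmf_of_set P)) borel g"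
    unfolding eq by (subst distr_distr) (auto simp: gm comp_def)
  \<comment> \<open>Passing through the discrete sigma-algebra turns the image under
    \<open>g\<close> into a \<open>map_pmf\<close>, and the permutation \<open>g\<close> of
    \<open>P\<close> preserves the uniform distribution.\<close>
  also have "\<dots> = distr (distr (measure_pmf (pmf_of_set P)) (count_space UNIV) g) borel (\<lambda>x. x)"
    by (subst distr_distr) (auto simp: comp_def)
  also have "distr (measure_pmf (pmf_of_set P)) (count_space UNIV) g = measure_pmf (map_pmf g (pmf_of_set P))"
    by (simp add: map_pmf_rep_eq)
  also have "map_pmf g (pmf_of_set P) = pmf_of_set P"
    using periodic_orbit_bij[OF P] map_pmf_of_set_inj[of g P] ne fin by (simp add: bij_betw_def)
  finally have "distr (orbit_measure P) borel g = orbit_measure P"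
    by (simp add: eq)
  moreover have "prob_space (orbit_measure P)"
    unfolding eq by (intro prob_space.prob_space_distr) (auto simp: prob_space_measure_pmf)
  ultimately show "orbit_measure P \<in> invariant_measures g"
    unfolding invariant_measures_def by (simp add: eq)
  have "P \<in> sets borel"
    using fin by (simp add: borel_closed finite_imp_closed)
  then show "AE x in orbit_measure P. x \<in> P"
    unfolding eq by (subst AE_distr_iff) (auto simp: AE_measure_pmf_iff fin ne)
qed

lemma bounded_continuous_integrable:
  fixes \<phi> :: "'a::metric_space \<Rightarrow> real"
  assumes "compact (UNIV :: 'a set)" "continuous_on UNIV \<phi>" "\<mu> \<in> invariant_measures g"
  shows "integrable \<mu> \<phi>"
proof -
  note D = invariant_measuresD[OF assms(3)]
  interpret prob_space \<mu> by (rule D)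
  have "bounded (range \<phi>)"
    using compact_continuous_image[OF assms(2,1)] by (rule compact_imp_bounded)
  then obtain B where "\<And>x. norm (\<phi> x) \<le> B"
    unfolding bounded_iff by auto
  moreover have "\<phi> \<in> borel_measurable \<mu>"
    using borel_measurable_continuous_onI[OF assms(2)] by (simp add: measurable_cong_sets[OF D(1) refl])
  ultimately show ?thesis
    by (intro integrable_const_bound[of _ B]) auto
qed

text \<open>Integration and invariance give \<open>N\<close> times the claim with an error
  \<open>M\<close> that does not grow with \<open>N\<close>; large \<open>N\<close> removes it. A
  bound at nonwandering points suffices, as they carry all the mass.\<close>

lemma integral_le_of_birkhoff_sum_le:
  fixes g :: "'a::metric_space \<Rightarrow> 'a" and \<phi> :: "'a \<Rightarrow> real"
  assumes X: "compact (UNIV :: 'a set)" and \<mu>: "\<mu> \<in> invariant_measures g"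
    and g: "continuous_on UNIV g" and \<phi>: "continuous_on UNIV \<phi>" and B: "B \<in> sets borel"
    and bound: "\<And>x N. x \<in> nonwandering g \<Longrightarrow>
      (\<Sum>m<N. \<phi> ((g ^^ m) x)) \<le> N * \<beta> + M - c * (\<Sum>m<N. indicator B ((g ^^ m) x))"
  shows "integral\<^sup>L \<mu> \<phi> \<le> \<beta> - c * measure \<mu> B"
proof -
  note D = invariant_measuresD[OF \<mu>]
  interpret prob_space \<mu> by (rule D)
  have gn: "continuous_on UNIV (g ^^ n)" for n
    by (induction n) (auto intro: continuous_on_compose2[OF g] simp: id_def)
  have int\<phi>: "integrable \<mu> (\<lambda>x. \<phi> ((g ^^ m) x))" for m
    by (rule bounded_continuous_integrable[OF X _ \<mu>])
      (rule continuous_on_compose2[OF \<phi> gn], simp)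
  have Bm: "(\<lambda>x. indicator B x :: real) \<in> borel_measurable borel"
    using B by measurable
  have mB: "(\<lambda>x. indicator B ((g ^^ m) x) :: real) \<in> borel_measurable \<mu>" for m
    using measurable_compose[OF measurable_funpow_continuous[OF g, of m] Bm]
    by (simp add: measurable_cong_sets[OF D(1) refl])
  have intB: "integrable \<mu> (\<lambda>x. indicator B ((g ^^ m) x) :: real)" for m
    by (rule integrable_const_bound[of _ 1]) (use mB in \<open>auto simp: indicator_def\<close>)
  have main: "N * integral\<^sup>L \<mu> \<phi> \<le> N * \<beta> + M - c * (N * measure \<mu> B)" for N :: nat
  proof -
    have "(\<Sum>m<N. integral\<^sup>L \<mu> \<phi>) = (\<Sum>m<N. \<integral>x. \<phi> ((g ^^ m) x) \<partial>\<mu>)"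
      using integral_funpow_invariant[OF \<mu> g borel_measurable_continuous_onI[OF \<phi>]] by simp
    also have "\<dots> = (\<integral>x. (\<Sum>m<N. \<phi> ((g ^^ m) x)) \<partial>\<mu>)"
      by (rule Bochner_Integration.integral_sum[symmetric]) (rule int\<phi>)
    also have "\<dots> \<le> (\<integral>x. N * \<beta> + M - c * (\<Sum>m<N. indicator B ((g ^^ m) x)) \<partial>\<mu>)"
    proof (rule integral_mono_AE)
      show "AE x in \<mu>. (\<Sum>m<N. \<phi> ((g ^^ m) x)) \<le> N * \<beta> + M - c * (\<Sum>m<N. indicator B ((g ^^ m) x))"
        using AE_nonwandering[OF X \<mu> g] by (rule AE_mp) (auto intro!: AE_I2 bound)
    qed (auto intro!: Bochner_Integration.integrable_sum Bochner_Integration.integrable_diff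
        integrable_mult_right int\<phi> intB)
    also have "\<dots> = N * \<beta> + M - c * (\<Sum>m<N. \<integral>x. indicator B ((g ^^ m) x) \<partial>\<mu>)"
      using intB by (simp add: Bochner_Integration.integral_sum Bochner_Integration.integrable_sum prob_space)
    also have "(\<Sum>m<N. \<integral>x. indicator B ((g ^^ m) x) \<partial>\<mu>) = N * measure \<mu> B"
      using integral_funpow_invariant[OF \<mu> g Bm] by (simp add: D)
    finally show ?thesis by simp
  qed
  show ?thesis
  proof (rule ccontr)
    assume "\<not> ?thesis"
    then have pos: "0 < integral\<^sup>L \<mu> \<phi> - (\<beta> - c * measure \<mu> B)" by simp
    obtain N :: nat where "M < N * (integral\<^sup>L \<mu> \<phi> - (\<beta> - c * measure \<mu> B))"
      using reals_Archimedean3[OF pos] by auto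
    with main[of N] show False by (simp add: algebra_simps)
  qed
qed

subsection \<open>Shadowing and the perturbed maximization problem\<close>

lemma finite_imp_uniform_discrete:
  fixes S :: "'a::metric_space set"
  assumes "finite S"
  shows "uniform_discrete S"
proof -
  \<comment> \<open>The inserted 1 keeps the set nonempty when \<open>S\<close> has at most one
    point.\<close>
  let ?D = "insert 1 ((\<lambda>(x, y). dist x y) ` {(x, y) \<in> S \<times> S. x \<noteq> y})"
  have fin: "finite ?D"
    using assms by (intro finite.insertI finite_imageI finite_subset[OF _ finite_cartesian_product[of S S]]) auto
  have "0 < Min ?D"
    using fin by (subst Min_gr_iff) auto
  moreover have "Min ?D \<le> dist x y" if "x \<in> S" "y \<in> S" "x \<noteq> y" for x y
    using fin that by (intro Min_le) auto
  ultimately show ?thesis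
    by (rule uniformI2)
qed

lemma infdist_lessE:
  assumes "infdist x P < \<rho>" "P \<noteq> {}"
  obtains y where "y \<in> P" "dist x y < \<rho>"
proof -
  have "(INF y\<in>P. dist x y) < \<rho>"
    using assms by (simp add: infdist_notempty)
  then show ?thesis
    using cInf_lessD[of "dist x ` P" \<rho>] assms(2) that by auto
qed

text \<open>The companion of \<open>x\<close> in \<open>P\<close> can be followed in time: its next
  iterate and the point of \<open>P\<close> nearby the next iterate of \<open>x\<close> are less
  than \<open>(1 + \<Lambda>) * \<rho>\<close> apart, so the separation of \<open>P\<close> makes
  them equal.\<close>

lemma orbit_shadowing:
  fixes g :: "'a::metric_space \<Rightarrow> 'a"
  assumes lip: "\<And>x y. dist (g x) (g y) \<le> \<Lambda> * dist x y" and "0 \<le> \<Lambda>"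
    and P: "P \<noteq> {}" "g ` P \<subseteq> P"
    and sep: "\<And>y y'. y \<in> P \<Longrightarrow> y' \<in> P \<Longrightarrow> y \<noteq> y' \<Longrightarrow> (1 + \<Lambda>) * \<rho> \<le> dist y y'"
    and near: "\<And>m. m \<le> n \<Longrightarrow> infdist ((g ^^ m) x) P < \<rho>"
  obtains y where "y \<in> P" "\<And>m. m \<le> n \<Longrightarrow> dist ((g ^^ m) x) ((g ^^ m) y) < \<rho>"
proof -
  obtain y where y: "y \<in> P" "dist x y < \<rho>"
    using infdist_lessE[OF _ P(1)] near[of 0] by auto
  have gy: "(g ^^ m) y \<in> P" for m
    by (induction m) (use y(1) P(2) in auto)
  have "dist ((g ^^ m) x) ((g ^^ m) y) < \<rho>" if "m \<le> n" for m
    using that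
  proof (induction m)
    case (Suc m)
    obtain y' where y': "y' \<in> P" "dist ((g ^^ Suc m) x) y' < \<rho>"
      using infdist_lessE[OF near[OF Suc.prems] P(1)] by auto
    have "dist ((g ^^ Suc m) x) ((g ^^ Suc m) y) \<le> \<Lambda> * dist ((g ^^ m) x) ((g ^^ m) y)"
      using lip by simp
    also have "\<dots> \<le> \<Lambda> * \<rho>"
      using Suc \<open>0 \<le> \<Lambda>\<close> by (intro mult_left_mono) auto
    finally have "dist y' ((g ^^ Suc m) y) < (1 + \<Lambda>) * \<rho>"
      using y'(2) dist_triangle3[of y' "(g ^^ Suc m) y" "(g ^^ Suc m) x"] by (simp add: algebra_simps)
    then have "y' = (g ^^ Suc m) y"
      using sep[OF y'(1) gy] by (meson not_le)
    then show ?case using y' by simp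
  qed (use y in simp)
  with y(1) show ?thesis using that by blast
qed

text \<open>The quantitative core for one \<open>g\<close> and one \<open>d > 0\<close>, with all
  constants explicit. The first inequality in \<open>const\<close> makes \<open>C\<close> large
  against the errors free of \<open>C\<close>; the second makes \<open>d\<close> small enough to
  absorb the error from \<xi>, which carries the factor \<open>C\<close> itself. Each uses half of
  \<open>C * \<rho> powr \<alpha>\<close>.\<close>

lemma perturbed_maximizing_measures:
  fixes f g :: "'a::metric_space \<Rightarrow> 'a" and \<phi> \<xi> u :: "'a \<Rightarrow> real"
    and P :: "'a set" and \<alpha> \<rho> \<Lambda> K \<kappa> \<delta> d A L Q B C :: real and k :: nat
  defines "q \<equiv> \<kappa> powr (- \<alpha>)"
    and "\<Phi> \<equiv> \<lambda>x. \<phi> x - 2 * C * A * d powr (\<alpha> / 2) * infdist x P powr \<alpha> + \<xi> x"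
  assumes X: "compact (UNIV :: 'a set)" and \<alpha>: "0 < \<alpha>" "\<alpha> \<le> 1"
    and g: "continuous_on UNIV g" and lip: "\<And>x y. dist (g x) (g y) \<le> \<Lambda> * dist x y" and \<Lambda>: "0 \<le> \<Lambda>"
    and K: "0 < K" and \<kappa>: "1 < \<kappa>"
    and RHE: "\<And>x y n m. x \<in> nonwandering g \<Longrightarrow> y \<in> nonwandering g \<Longrightarrow>
        (\<And>m. m \<le> n \<Longrightarrow> dist ((g ^^ m) x) ((g ^^ m) y) < \<delta>) \<Longrightarrow> m \<le> n \<Longrightarrow>
        dist ((g ^^ m) x) ((g ^^ m) y)
          \<le> K * \<kappa> powr (- real (min m (n - m))) * (dist x y + dist ((g ^^ n) x) ((g ^^ n) y))"
    and P: "periodic_orbit g P"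
    and \<rho>: "0 < \<rho>" "\<rho> \<le> \<delta>"
    and sep: "\<And>y y'. y \<in> P \<Longrightarrow> y' \<in> P \<Longrightarrow> y \<noteq> y' \<Longrightarrow> (1 + \<Lambda>) * \<rho> \<le> dist y y'"
    and i: "\<And>x. x \<in> nonwandering g \<Longrightarrow> i x \<in> nonwandering f"
      "\<And>x. x \<in> nonwandering g \<Longrightarrow> i (g x) = f (i x)"
      "\<And>x. x \<in> nonwandering g \<Longrightarrow> dist (i x) x \<le> d"
    and d: "0 < d" "d \<le> 1"
    and A: "0 < A" and \<phi>: "continuous_on UNIV \<phi>" "\<And>x y. \<bar>\<phi> x - \<phi> y\<bar> \<le> A * dist x y powr \<alpha>"
    and L: "0 \<le> L" and u: "\<And>x y. x \<in> nonwandering f \<Longrightarrow> y \<in> nonwandering f \<Longrightarrow>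
        \<bar>u x - u y\<bar> \<le> L * A * dist x y powr \<alpha>"
    and sub: "\<And>x. x \<in> nonwandering f \<Longrightarrow> \<phi> x + u x - u (f x) \<le> Q"
    and avg: "Q - A * d powr \<alpha> \<le> sum \<phi> P / card P"
    and C: "0 \<le> C"
    and \<xi>: "continuous_on UNIV \<xi>"
      "\<And>x y. \<bar>\<xi> x - \<xi> y\<bar> \<le> 5 * C * A * d powr (\<alpha> / 2) * dist x y powr \<alpha>"
      "\<And>x. \<bar>\<xi> x\<bar> \<le> A * d powr \<alpha>"
    and k: "2 * K * \<rho> * \<kappa> powr (- real k) \<le> d" "real k * d powr (\<alpha> / 2) \<le> B"
    and const: "8 * B + 4 * card P + 2 + 2 / (1 - q) + 2 * L * (\<Lambda> + 3) \<le> C * \<rho> powr \<alpha> / 2"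
      "10 * d powr \<alpha> / (1 - q) \<le> \<rho> powr \<alpha> / 2"
  shows "maximizing_measures g \<Phi> = {orbit_measure P}"
proof -
  note fin = periodic_orbit_finite[OF P] and ne = periodic_orbit_nonempty[OF P]
  have p: "0 < card P" using fin ne by (simp add: card_gt_0_iff)
  have gP: "g ` P \<subseteq> P" using periodic_orbit_bij[OF P] by (simp add: bij_betw_def)
  have P\<Omega>: "y \<in> nonwandering g" if "y \<in> P" for y
    using periodic_orbit_nonwandering[OF P] that by auto
  have \<Omega>: "(g ^^ m) x \<in> nonwandering g" if "x \<in> nonwandering g" for m x
    by (rule funpow_in_nonwandering[OF g that])
  have q: "0 < q" "q < 1"
    unfolding q_def using \<kappa> \<alpha> powr_less_mono[of "- \<alpha>" 0 \<kappa>] by auto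
  \<comment> \<open>In terms of \<open>s\<close> the errors per step are of order
    \<open>s * s\<close>, while the penalty at a fixed distance is of order
    \<open>s\<close>.\<close>
  define s where "s = d powr (\<alpha> / 2)"
  have s: "0 < s" "s \<le> 1" "d powr \<alpha> = s * s"
    unfolding s_def using d \<alpha> by (auto simp: powr_le1 powr_add[symmetric])
  define T where "T = 2 * K * \<rho>"
  have T: "0 < T" unfolding T_def using K \<rho> by simp

  \<comment> \<open>Exponential shadowing of orbit segments near \<open>P\<close>\<close>
  have contr: "\<exists>y\<in>P. \<forall>m\<le>n. dist ((g ^^ m) x) ((g ^^ m) y) \<le> T * \<kappa> powr (- real (min m (n - m)))"
    if x: "x \<in> nonwandering g" and near: "\<And>m. m \<le> n \<Longrightarrow> infdist ((g ^^ m) x) P < \<rho>" for x n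
  proof -
    obtain y where y: "y \<in> P" "\<And>m. m \<le> n \<Longrightarrow> dist ((g ^^ m) x) ((g ^^ m) y) < \<rho>"
      using orbit_shadowing[where x = x and n = n, OF lip \<Lambda> ne gP sep near] by blast
    have "dist ((g ^^ m) x) ((g ^^ m) y) \<le> T * \<kappa> powr (- real (min m (n - m)))" if m: "m \<le> n" for m
    proof -
      have "dist ((g ^^ m) x) ((g ^^ m) y)
          \<le> K * \<kappa> powr (- real (min m (n - m))) * (dist x y + dist ((g ^^ n) x) ((g ^^ n) y))"
        by (rule RHE[OF x P\<Omega>[OF y(1)] _ m]) (use y(2) \<rho>(2) in fastforce)
      also have "\<dots> \<le> K * \<kappa> powr (- real (min m (n - m))) * (2 * \<rho>)"
        using y(2)[of 0] y(2)[of n] K by (intro mult_left_mono) auto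
      finally show ?thesis by (simp add: T_def algebra_simps)
    qed
    with y(1) show ?thesis by blast
  qed

  \<comment> \<open>The transported sub-action and the cohomologous function\<close>
  define v where "v = u \<circ> i"
  \<comment> \<open>Since \<open>i\<close> may move both points by \<open>d\<close>, the Hoelder
    estimate of \<open>u\<close> passes to \<open>v\<close> only with \<open>2 * d\<close> added to
    the distance.\<close>
  have v: "\<bar>v x - v y\<bar> \<le> L * A * (dist x y + 2 * d) powr \<alpha>"
    if "x \<in> nonwandering g" "y \<in> nonwandering g" for x y
  proof -
    have "dist (i x) (i y) \<le> dist (i x) x + dist x y + dist (i y) y"
      using dist_triangle[of "i x" "i y" x] dist_triangle[of x "i y" y] by (simp add: dist_commute)
    also have "\<dots> \<le> dist x y + 2 * d"
      using i(3)[OF that(1)] i(3)[OF that(2)] by simp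
    finally have "L * A * dist (i x) (i y) powr \<alpha> \<le> L * A * (dist x y + 2 * d) powr \<alpha>"
      using L A \<alpha> by (intro mult_left_mono powr_mono2) auto
    then show ?thesis
      using u[OF i(1)[OF that(1)] i(1)[OF that(2)]] by (simp add: v_def)
  qed

  have "continuous_on UNIV (\<lambda>x. infdist x P powr \<alpha>)"
    using \<alpha> by (intro continuous_on_powr' continuous_intros) (auto simp: infdist_nonneg)
  then have \<Phi>cont: "continuous_on UNIV \<Phi>"
    unfolding \<Phi>_def by (intro continuous_on_add continuous_on_diff continuous_on_mult continuous_on_const \<phi> \<xi>)
  define \<beta> where "\<beta> = sum \<Phi> P / card P"
  have \<Phi>P: "\<Phi> y = \<phi> y + \<xi> y" if "y \<in> P" for y
    using that by (simp add: \<Phi>_def)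
  \<comment> \<open>One error \<open>A * d powr \<alpha>\<close> comes from \<open>avg\<close>, the
    other from the sup bound on \<xi>; the penalty vanishes on \<open>P\<close>.\<close>
  have \<beta>: "Q - 2 * A * (s * s) \<le> \<beta>"
  proof -
    have "- (card P * (A * d powr \<alpha>)) = (\<Sum>y\<in>P. - (A * d powr \<alpha>))"
      by simp
    also have "\<dots> \<le> sum \<xi> P"
      by (intro sum_mono) (metis \<xi>(3) abs_le_iff minus_le_iff)
    finally have "- (A * d powr \<alpha>) \<le> sum \<xi> P / card P"
      using p by (simp add: pos_le_divide_eq mult.commute)
    moreover have "\<beta> = sum \<phi> P / card P + sum \<xi> P / card P"
      unfolding \<beta>_def by (simp add: \<Phi>P sum.distrib add_divide_distrib)
    ultimately show ?thesis
      using avg s(3) by simp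
  qed

  define \<psi> where "\<psi> x = \<Phi> x - \<beta> + v x - v (g x)" for x
  \<comment> \<open>The factor 4 collects one error from replacing \<open>x\<close> by
    \<open>i x\<close>, one from \<xi>, and two from the lower bound on \<beta>.\<close>
  have \<psi>: "\<psi> x \<le> 4 * A * (s * s) - 2 * C * A * s * infdist x P powr \<alpha>" if x: "x \<in> nonwandering g" for x
  proof -
    have "\<phi> x \<le> \<phi> (i x) + A * dist (i x) x powr \<alpha>"
      using \<phi>(2)[of "i x" x] by linarith
    also have "A * dist (i x) x powr \<alpha> \<le> A * d powr \<alpha>"
      using i(3)[OF x] A \<alpha> by (intro mult_left_mono powr_mono2) auto
    finally have "\<phi> x + v x - v (g x) \<le> Q + A * (s * s)"
      using sub[OF i(1)[OF x]] i(2)[OF x] s(3) by (simp add: v_def)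
    moreover have "\<xi> x \<le> A * (s * s)"
      using \<xi>(3)[of x] s(3) by simp
    ultimately show ?thesis
      using \<beta> unfolding \<psi>_def \<Phi>_def s_def[symmetric] by linarith
  qed
  define e where "e = 4 * A * (s * s)"
  have e: "0 < e" unfolding e_def using A s by simp
  have \<psi>e: "\<psi> x \<le> e" if "x \<in> nonwandering g" for x
  proof -
    have "0 \<le> 2 * C * A * s * infdist x P powr \<alpha>"
      using C A s by simp
    then show ?thesis using \<psi>[OF that] unfolding e_def by linarith
  qed
  \<comment> \<open>The coboundary cancels because \<open>g\<close> permutes \<open>P\<close>, and
    \<beta> is the average of \<Phi>.\<close>
  have \<psi>P: "sum \<psi> P = 0"
  proof -
    have "(\<Sum>y\<in>P. v (g y)) = sum v P"
      by (rule sum.reindex_bij_betw[OF periodic_orbit_bij[OF P]])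
    moreover have "(\<Sum>y\<in>P. \<beta>) = sum \<Phi> P"
      using p by (simp add: \<beta>_def)
    ultimately show ?thesis
      unfolding \<psi>_def sum.distrib sum_subtractf by simp
  qed

  \<comment> \<open>Birkhoff sums along a run near \<open>P\<close>\<close>
  define D where "D = (1 + 5 * C * s) * A * (s * s)"
  define w where "w = L * A * (\<Lambda> + 3) * (s * s)"
  \<comment> \<open>Here \<open>D\<close> bounds the Hoelder variation of
    \<open>\<phi> + \<xi>\<close> over distance \<open>d\<close>, and \<open>w\<close> that of
    \<open>v\<close> over \<open>(\<Lambda> + 1) * d\<close> with the extra \<open>2 * d\<close>.
    The form of \<open>E\<close> is that of \<open>shadowing_run_sum_le\<close>, the periodic part
    costing \<open>card P * e\<close>.\<close>
  define E where "E = 2 * real k * e + card P * e + D * (2 / (1 - q)) + 2 * w"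
  have D: "0 \<le> D" unfolding D_def using C A s by simp
  have w: "0 \<le> w" unfolding w_def using L A \<Lambda> by simp
  have E: "0 < E"
    unfolding E_def using e p D w q
    by (intro add_pos_nonneg add_nonneg_pos mult_pos_pos mult_nonneg_nonneg) auto

  have run_Suc: "(\<Sum>m<Suc n. \<psi> ((g ^^ m) x)) \<le> E"
    if x: "x \<in> nonwandering g" and near: "\<And>m. m \<le> n \<Longrightarrow> infdist ((g ^^ m) x) P < \<rho>" for x n
  proof -
    obtain y where y: "y \<in> P"
      and xy: "\<And>m. m \<le> n \<Longrightarrow> dist ((g ^^ m) x) ((g ^^ m) y) \<le> T * \<kappa> powr (- real (min m (n - m)))"
      using contr[OF x near] by blast
    have yP: "(g ^^ m) y \<in> P" for m by (rule periodic_orbit_funpow[OF P y])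
    \<comment> \<open>After \<open>k\<close> steps from an end the shadowing distance is at most
      \<open>d\<close>, and it decays further from there at the same rate.\<close>
    have pw: "T * \<kappa> powr (- real j) \<le> d * \<kappa> powr (- real (j - k))" if "k \<le> j" for j
    proof -
      have "\<kappa> powr (- real j) = \<kappa> powr (- real k) * \<kappa> powr (- real (j - k))"
        using that by (simp add: powr_add[symmetric])
      then have "T * \<kappa> powr (- real j) = T * \<kappa> powr (- real k) * \<kappa> powr (- real (j - k))"
        by simp
      also have "\<dots> \<le> d * \<kappa> powr (- real (j - k))"
        using k(1) by (intro mult_right_mono) (auto simp: T_def)
      finally show ?thesis .
    qed
    have "(\<Sum>m<Suc n. (\<Phi> ((g ^^ m) x) - \<beta>) + v ((g ^^ m) x) - v ((g ^^ Suc m) x))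
        \<le> 2 * real k * e + card P * e + D * (2 / (1 - q)) + 2 * w"
    proof (rule shadowing_run_sum_le[where a = "\<lambda>m. \<Phi> ((g ^^ m) x) - \<beta>" and vx = "\<lambda>m. v ((g ^^ m) x)"
          and b = "\<lambda>m. \<Phi> ((g ^^ m) y) - \<beta>" and vy = "\<lambda>m. v ((g ^^ m) y)"])
      show "\<Phi> ((g ^^ m) x) - \<beta> + v ((g ^^ m) x) - v ((g ^^ Suc m) x) \<le> e" for m
        using \<psi>e[OF \<Omega>[OF x, of m]] by (simp add: \<psi>_def)
      show "(\<Sum>m<l. \<Phi> ((g ^^ (m + j)) y) - \<beta> + v ((g ^^ (m + j)) y) - v ((g ^^ Suc (m + j)) y)) \<le> card P * e" for j l
        using periodic_orbit_sum_le[OF P \<psi>P \<psi>e[OF P\<Omega>] less_imp_le[OF e] yP[of j], of l]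
        by (simp add: \<psi>_def funpow_add)
      show "\<Phi> ((g ^^ m) x) - \<beta> - (\<Phi> ((g ^^ m) y) - \<beta>) \<le> D * q ^ (min m (n - m) - k)"
        if m: "k \<le> m" "m + k \<le> n" for m
      proof -
        define j where "j = min m (n - m) - k"
        let ?t = "dist ((g ^^ m) x) ((g ^^ m) y)"
        have "?t \<le> d * \<kappa> powr (- real j)"
          using xy[of m] pw[of "min m (n - m)"] m unfolding j_def by linarith
        then have "?t powr \<alpha> \<le> (d * \<kappa> powr (- real j)) powr \<alpha>"
          using \<alpha> by (intro powr_mono2) auto
        also have "\<dots> = d powr \<alpha> * q ^ j"
          using d \<kappa> by (simp add: powr_mult powr_powr q_def powr_realpow[symmetric] mult.commute)
        finally have t: "?t powr \<alpha> \<le> s * s * q ^ j" by (simp add: s(3))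
        have "0 \<le> 2 * C * A * d powr (\<alpha> / 2) * infdist ((g ^^ m) x) P powr \<alpha>"
          using C A by simp
        then have "\<Phi> ((g ^^ m) x) - \<Phi> ((g ^^ m) y)
            \<le> (\<phi> ((g ^^ m) x) - \<phi> ((g ^^ m) y)) + (\<xi> ((g ^^ m) x) - \<xi> ((g ^^ m) y))"
          unfolding \<Phi>P[OF yP] unfolding \<Phi>_def by linarith
        also have "\<dots> \<le> A * ?t powr \<alpha> + 5 * C * A * s * ?t powr \<alpha>"
          using \<phi>(2)[of "(g ^^ m) x" "(g ^^ m) y"] \<xi>(2)[of "(g ^^ m) x" "(g ^^ m) y"]
          unfolding s_def by linarith
        also have "\<dots> = (1 + 5 * C * s) * A * ?t powr \<alpha>"
          by (simp add: algebra_simps)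
        also have "\<dots> \<le> (1 + 5 * C * s) * A * (s * s * q ^ j)"
          using t C A s by (intro mult_left_mono) auto
        finally show ?thesis by (simp add: D_def j_def mult.assoc)
      qed
      show "\<bar>v ((g ^^ m) x) - v ((g ^^ m) y)\<bar> \<le> w" if m: "k \<le> m" "m + k \<le> Suc n" "2 * k \<le> n" for m
      proof -
        have small: "dist ((g ^^ m) x) ((g ^^ m) y) \<le> d" if "k \<le> m" "m + k \<le> n" for m
        proof -
          have "\<kappa> powr (- real (min m (n - m) - k)) \<le> \<kappa> powr 0"
            using \<kappa> by (intro powr_mono) auto
          then have "d * \<kappa> powr (- real (min m (n - m) - k)) \<le> d"
            using d \<kappa> by (simp add: mult_left_le)
          then show ?thesis
            using xy[of m] pw[of "min m (n - m)"] that by linarith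
        qed
        \<comment> \<open>The index \<open>m = n + 1 - k\<close> lies one step beyond the range of
          \<open>small\<close> and is reached by one Lipschitz step from \<open>m'\<close>;
          \<open>2 * k \<le> n\<close> guarantees \<open>k \<le> m'\<close>.\<close>
        have "dist ((g ^^ m) x) ((g ^^ m) y) \<le> (\<Lambda> + 1) * d"
        proof (cases "m + k \<le> n")
          case True
          then show ?thesis
            using small[OF m(1)] \<Lambda> d by (simp add: distrib_right add_increasing)
        next
          case False
          then obtain m' where m': "m = Suc m'"
            using m(3) by (cases m) auto
          have "dist ((g ^^ m) x) ((g ^^ m) y) \<le> \<Lambda> * dist ((g ^^ m') x) ((g ^^ m') y)"
            using lip by (simp add: m')
          also have "\<dots> \<le> \<Lambda> * d"
            using small[of m'] False m m' \<Lambda> by (intro mult_left_mono) auto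
          finally show ?thesis using d by (simp add: distrib_right)
        qed
        then have "(dist ((g ^^ m) x) ((g ^^ m) y) + 2 * d) powr \<alpha> \<le> ((\<Lambda> + 3) * d) powr \<alpha>"
          using d \<alpha> by (intro powr_mono2) (auto simp: algebra_simps)
        also have "\<dots> = (\<Lambda> + 3) powr \<alpha> * (s * s)"
          using d \<Lambda> by (simp add: powr_mult s(3))
        also have "\<dots> \<le> (\<Lambda> + 3) * (s * s)"
          using \<alpha> \<Lambda> powr_mono[of \<alpha> 1 "\<Lambda> + 3"] by (intro mult_right_mono) auto
        finally have "L * A * (dist ((g ^^ m) x) ((g ^^ m) y) + 2 * d) powr \<alpha> \<le> w"
          unfolding w_def mult.assoc[of "L * A"] using L A by (intro mult_left_mono) auto
        then show ?thesis
          using v[OF \<Omega>[OF x] P\<Omega>[OF yP], of m m] by linarith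
      qed
    qed (use e D q w in auto)
    then show ?thesis
      by (simp add: \<psi>_def E_def)
  qed

  \<comment> \<open>The cost of the far region\<close>
  define bad where "bad = {x. \<rho> \<le> infdist x P}"
  \<comment> \<open>This is half the loss guaranteed at a point of \<open>bad\<close>; one half pays
    for the adjoining run, the other remains as gain.\<close>
  define c where "c = C * A * s * \<rho> powr \<alpha> - 2 * A * (s * s)"
  have run: "(\<Sum>m<n. \<psi> ((g ^^ m) x)) \<le> E"
    if "x \<in> nonwandering g" "\<And>m. m < n \<Longrightarrow> (g ^^ m) x \<notin> bad" for x n
  proof (cases n)
    case (Suc n')
    have "infdist ((g ^^ m) x) P < \<rho>" if "m \<le> n'" for m
      using \<open>\<And>m. m < n \<Longrightarrow> (g ^^ m) x \<notin> bad\<close>[of m] that Suc by (simp add: bad_def not_le)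
    then show ?thesis
      unfolding Suc by (rule run_Suc[OF that(1)])
  qed (use E in simp)
  have bad_le: "\<psi> x \<le> - 2 * c" if "x \<in> nonwandering g" "x \<in> bad" for x
  proof -
    have "\<rho> powr \<alpha> \<le> infdist x P powr \<alpha>"
      using that(2) \<rho> \<alpha> by (intro powr_mono2) (auto simp: bad_def)
    then have "2 * C * A * s * \<rho> powr \<alpha> \<le> 2 * C * A * s * infdist x P powr \<alpha>"
      using C A s by (intro mult_left_mono) auto
    then show ?thesis
      using \<psi>[OF that(1)] unfolding c_def by (simp add: algebra_simps)
  qed
  \<comment> \<open>After division by \<open>A * s\<close>, the only error containing
    \<open>C\<close> is the one from \<xi>; it is bounded by the second inequality of
    \<open>const\<close>, all others by the first.\<close>
  have "E \<le> c"
  proof -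
    let ?R = "2 / (1 - q)"
    have R: "0 \<le> ?R" using q by simp
    have ks: "real k * s \<le> B" using k(2) by (simp add: s_def)
    have "4 * card P * s + ?R * s + 2 * L * (\<Lambda> + 3) * s + 2 * s \<le> 4 * card P + ?R + 2 * L * (\<Lambda> + 3) + 2"
      using s L \<Lambda> R by (intro add_mono mult_left_le) auto
    moreover have "?R * 5 * C * (s * s) \<le> C * (\<rho> powr \<alpha> / 2)"
      using mult_left_mono[OF const(2) C] by (simp add: s(3) algebra_simps)
    ultimately have "8 * (real k * s) + 4 * card P * s + ?R * s + 2 * L * (\<Lambda> + 3) * s + 2 * s + ?R * 5 * C * (s * s)
        \<le> C * \<rho> powr \<alpha>"
      using ks const(1) by linarith
    then have "A * s * (8 * (real k * s) + 4 * card P * s + ?R * s + 2 * L * (\<Lambda> + 3) * s + 2 * s + ?R * 5 * C * (s * s))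
        \<le> A * s * (C * \<rho> powr \<alpha>)"
      using A s by (intro mult_left_mono) auto
    moreover have "E + 2 * A * (s * s) =
        A * s * (8 * (real k * s) + 4 * card P * s + ?R * s + 2 * L * (\<Lambda> + 3) * s + 2 * s + ?R * 5 * C * (s * s))"
      unfolding E_def e_def D_def w_def by (simp only: algebra_simps)
    ultimately show ?thesis unfolding c_def by (simp add: algebra_simps)
  qed
  then have c: "0 < c" using E by simp

  \<comment> \<open>From Birkhoff sums to integrals\<close>
  define M where "M = E + L * A * (diameter (UNIV :: 'a set) + 2 * d) powr \<alpha>"
  \<comment> \<open>The coboundary of \<open>v\<close> telescopes to two values of \<open>v\<close>,
    whose difference is bounded through the diameter of the space; hence \<open>M\<close> is
    independent of \<open>N\<close>.\<close>
  have bound: "(\<Sum>m<N. \<Phi> ((g ^^ m) x)) \<le> N * \<beta> + M - c * (\<Sum>m<N. indicator bad ((g ^^ m) x))"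
    if x: "x \<in> nonwandering g" for x N
  proof -
    have "(\<Sum>m<N. \<psi> ((g ^^ m) x)) =
        (\<Sum>m<N. \<Phi> ((g ^^ m) x)) - N * \<beta> + (\<Sum>m<N. v ((g ^^ m) x) - v ((g ^^ Suc m) x))"
      by (simp add: \<psi>_def sum.distrib sum_subtractf)
    also have "(\<Sum>m<N. v ((g ^^ m) x) - v ((g ^^ Suc m) x)) = v x - v ((g ^^ N) x)"
      using sum_lessThan_telescope'[of "\<lambda>m. v ((g ^^ m) x)" N] by simp
    finally have 1: "(\<Sum>m<N. \<Phi> ((g ^^ m) x)) = (\<Sum>m<N. \<psi> ((g ^^ m) x)) + N * \<beta> - (v x - v ((g ^^ N) x))"
      by simp
    have "(dist x ((g ^^ N) x) + 2 * d) powr \<alpha> \<le> (diameter (UNIV :: 'a set) + 2 * d) powr \<alpha>"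
      using diameter_bounded_bound[OF compact_imp_bounded[OF X]] d \<alpha> by (intro powr_mono2) auto
    then have "L * A * (dist x ((g ^^ N) x) + 2 * d) powr \<alpha> \<le> L * A * (diameter (UNIV :: 'a set) + 2 * d) powr \<alpha>"
      using L A by (intro mult_left_mono) auto
    then have 2: "- (v x - v ((g ^^ N) x)) \<le> L * A * (diameter (UNIV :: 'a set) + 2 * d) powr \<alpha>"
      using v[OF x \<Omega>[OF x], of N] by linarith
    have "(\<Sum>m<N. \<psi> ((g ^^ m) x)) \<le> E - c * (\<Sum>m<N. indicator bad ((g ^^ m) x))"
      using nonwandering_forward_invariant[OF g] run bad_le \<open>E \<le> c\<close> x by (rule birkhoff_sum_le_count)
    with 1 2 show ?thesis unfolding M_def by linarith
  qed
  have bad_closed: "closed bad"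
    unfolding bad_def by (intro closed_Collect_le continuous_intros)
  then have bad_borel: "bad \<in> sets borel" by simp
  note int_le = integral_le_of_birkhoff_sum_le[OF X _ g \<Phi>cont bad_borel bound]
  have int_P: "integral\<^sup>L (orbit_measure P) \<Phi> = \<beta>"
    unfolding \<beta>_def by (rule integral_orbit_measure[OF fin ne borel_measurable_continuous_onI[OF \<Phi>cont]])
  note P_inv = orbit_measure_invariant[OF P g]

  \<comment> \<open>Uniqueness of the maximizing measure\<close>
  have unique: "\<mu> = orbit_measure P" if \<mu>: "\<mu> \<in> invariant_measures g" and "integral\<^sup>L \<mu> \<Phi> = \<beta>" for \<mu>
  proof -
    note \<mu>D = invariant_measuresD[OF \<mu>]
    interpret prob_space \<mu> by (rule \<mu>D)
    have "c * measure \<mu> bad \<le> 0"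
      using int_le[OF \<mu>] that(2) by simp
    then have "measure \<mu> bad = 0"
      using c by (simp add: mult_le_0_iff measure_le_0_iff)
    then have "bad \<in> null_sets \<mu>"
      using bad_borel by (auto simp: null_sets_def emeasure_eq_measure \<mu>D)
    then have "AE x in \<mu>. x \<in> - bad"
      using AE_not_in by fastforce
    then have "AE x in \<mu>. (g ^^ m) x \<in> - bad" for m
      by (intro AE_funpow_invariant[OF \<mu> g]) (use bad_borel in auto)
    then have "AE x in \<mu>. \<forall>m. (g ^^ m) x \<in> - bad"
      by (subst AE_all_countable) blast
    \<comment> \<open>Almost every orbit avoids \<open>bad\<close> forever, so shadowing applies
      over \<open>2 * m\<close> steps; it is read off at the midpoint, where the minimum in the
      exponent equals \<open>m\<close>.\<close>
    then have near: "AE x in \<mu>. infdist ((g ^^ m) x) P \<le> T * \<kappa> powr (- real m)" for m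
      using AE_nonwandering[OF X \<mu> g]
    proof eventually_elim
      case (elim x)
      then obtain y where y: "y \<in> P"
        "\<forall>j\<le>2 * m. dist ((g ^^ j) x) ((g ^^ j) y) \<le> T * \<kappa> powr (- real (min j (2 * m - j)))"
        using contr[of x "2 * m"] by (auto simp: bad_def not_le)
      from y(2)[rule_format, of m]
      have "dist ((g ^^ m) x) ((g ^^ m) y) \<le> T * \<kappa> powr (- real m)" by simp
      then show ?case
        by (rule infdist_le2[OF periodic_orbit_funpow[OF P y(1)]])
    qed
    have cont: "continuous_on UNIV (\<lambda>x. infdist x P)"
      by (intro continuous_intros)
    have int: "integrable \<mu> (\<lambda>x. infdist x P)"
      by (rule bounded_continuous_integrable[OF X cont \<mu>])
    \<comment> \<open>By invariance the mean distance to \<open>P\<close> equals that after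
      \<open>m\<close> steps, for every \<open>m\<close>, and therefore must vanish.\<close>
    have le: "(\<integral>x. infdist x P \<partial>\<mu>) \<le> T * \<kappa> powr (- real m)" for m
    proof -
      have gm: "continuous_on UNIV (g ^^ m)"
        by (induction m) (auto intro: continuous_on_compose2[OF g] simp: id_def)
      have "(\<integral>x. infdist x P \<partial>\<mu>) = (\<integral>x. infdist ((g ^^ m) x) P \<partial>\<mu>)"
        by (rule integral_funpow_invariant[OF \<mu> g borel_measurable_continuous_onI[OF cont], symmetric])
      also have "\<dots> \<le> (\<integral>x. T * \<kappa> powr (- real m) \<partial>\<mu>)"
        by (rule integral_mono_AE[OF bounded_continuous_integrable[OF X _ \<mu>] _ near])
          (use continuous_on_compose2[OF cont gm] in auto)
      finally show ?thesis by (simp add: prob_space)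
    qed
    have "(\<integral>x. infdist x P \<partial>\<mu>) \<le> 0"
    proof (rule field_le_epsilon)
      fix \<epsilon> :: real assume "0 < \<epsilon>"
      \<comment> \<open>The exponent lemma serves here to make
        \<open>\<kappa> powr (- real k)\<close> arbitrarily small.\<close>
      obtain B' where "\<And>r. 0 < r \<Longrightarrow> r \<le> 1 \<Longrightarrow> \<exists>k::nat. T * \<kappa> powr (- real k) \<le> r \<and> real k * r powr 1 \<le> B'"
        using ex_exponent_with_small_log[OF T \<kappa> zero_less_one] by blast
      from this[of "min 1 \<epsilon>"] \<open>0 < \<epsilon>\<close> obtain k' :: nat where "T * \<kappa> powr (- real k') \<le> \<epsilon>"
        by auto
      then show "(\<integral>x. infdist x P \<partial>\<mu>) \<le> 0 + \<epsilon>"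
        using le[of k'] by simp
    qed
    moreover have "0 \<le> (\<integral>x. infdist x P \<partial>\<mu>)"
      by (rule integral_nonneg_AE) (simp add: infdist_nonneg)
    ultimately have "AE x in \<mu>. infdist x P = 0"
      using integral_nonneg_eq_0_iff_AE[OF int] by (simp add: infdist_nonneg)
    then have "AE x in \<mu>. x \<in> P"
      using in_closed_iff_infdist_zero[OF finite_imp_closed[OF fin] ne] by simp
    then show ?thesis
      using invariant_measure_on_orbit_unique[OF P \<mu> _ P_inv g] by blast
  qed

  \<comment> \<open>The maximal integral\<close>
  have "max_integral g \<Phi> = \<beta>"
    unfolding max_integral_def
  proof (rule cSup_eq_maximum)
    show "\<beta> \<in> (\<lambda>\<mu>. integral\<^sup>L \<mu> \<Phi>) ` invariant_measures g"
      using P_inv(1) int_P by (metis imageI)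
    fix z assume "z \<in> (\<lambda>\<mu>. integral\<^sup>L \<mu> \<Phi>) ` invariant_measures g"
    then obtain \<mu> where "\<mu> \<in> invariant_measures g" "z = integral\<^sup>L \<mu> \<Phi>" by auto
    moreover have "0 \<le> c * measure \<mu> bad" using c by simp
    ultimately show "z \<le> \<beta>"
      using int_le[of \<mu>] by linarith
  qed
  then show ?thesis
    unfolding maximizing_measures_def by (auto intro: unique simp: P_inv(1) int_P)
qed

text \<open>Invariant measures of \<open>f\<close> live on its nonwandering set, so agreement of the
  maps there makes the image measures equal.\<close>

lemma invariant_measures_subset:
  fixes f g :: "'a::metric_space \<Rightarrow> 'a"
  assumes "compact (UNIV :: 'a set)" "continuous_on UNIV f" "continuous_on UNIV g"
    and "\<And>x. x \<in> nonwandering f \<Longrightarrow> f x = g x"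
  shows "invariant_measures f \<subseteq> invariant_measures g"
proof
  fix \<mu> assume \<mu>: "\<mu> \<in> invariant_measures f"
  note D = invariant_measuresD[OF \<mu>]
  have meas: "f \<in> measurable \<mu> borel" "g \<in> measurable \<mu> borel"
    using assms(2,3)[THEN borel_measurable_continuous_onI] by (simp_all add: measurable_cong_sets[OF D(1) refl])
  have "AE x in \<mu>. f x = g x"
    using AE_nonwandering[OF assms(1) \<mu> assms(2)] by eventually_elim (rule assms(4))
  then have "distr \<mu> borel f = distr \<mu> borel g"
    using meas by (intro distr_cong_AE) auto
  then show "\<mu> \<in> invariant_measures g"
    using D by (simp add: invariant_measures_def)
qed

theorem theorem2p3:
  fixes F :: "('a::metric_space \<Rightarrow> 'a) topology"
    and f :: "'a \<Rightarrow> 'a" and Orb :: "'a set" and \<alpha> :: real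
  assumes "compact (UNIV :: 'a set)"
    and "0 < \<alpha>" and "\<alpha> \<le> 1"
    and "\<forall>g\<in>topspace F. lipschitz_map g"
    and "f \<in> topspace F"
    and "stably_hyperbolic F f"
    and "periodic_orbit f Orb"
  shows "\<exists>U C \<epsilon>. openin F U \<and> f \<in> U \<and> C > 0 \<and> \<epsilon> > 0 \<and>
    (\<forall>g\<in>U.
      (\<exists>h i. semiconj_pair \<epsilon> f g h i) \<and>
      (\<forall>h i. semiconj_pair \<epsilon> f g h i \<longrightarrow>
        (let Orb_g = h ` Orb;
             d_g = max (sup_dist_id (nonwandering f) h) (sup_dist_id (nonwandering g) i)
         in \<forall>\<phi>. holder_on \<alpha> UNIV \<phi> \<and> \<not> \<phi> constant_on UNIV \<and>
                 maximizing_measures f \<phi> = {orbit_measure Orb} \<longrightarrow>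
              (\<forall>\<xi>. holder_on \<alpha> UNIV \<xi> \<and>
                    holder_seminorm \<alpha> UNIV \<xi>
                      \<le> 5 * C * holder_seminorm \<alpha> UNIV \<phi> * d_g powr (\<alpha> / 2) \<and>
                    sup_norm \<xi> \<le> holder_seminorm \<alpha> UNIV \<phi> * d_g powr \<alpha> \<longrightarrow>
                 {orbit_measure Orb_g} =
                 maximizing_measures g
                   (\<lambda>x. \<phi> x
                      - 2 * C * holder_seminorm \<alpha> UNIV \<phi> * d_g powr (\<alpha> / 2)
                          * infdist x Orb_g powr \<alpha>
                      + \<xi> x)))))"
proof -
  have lipm: "lipschitz_map g" if "g \<in> topspace F" for g
    using assms(4) that by blast
  have f: "continuous_on UNIV f"
    using lipschitz_map_continuous[OF lipm[OF assms(5)]] .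
  have IS: "cond_IS F f" and RHE: "cond_RHE F f" and Mane: "cond_ML f"
    using assms(6) by (auto simp: stably_hyperbolic_def)
  note X = assms(1) and \<alpha> = assms(2,3) and Orb = assms(7)
  note Orb_fin = periodic_orbit_finite[OF Orb] and Orb_ne = periodic_orbit_nonempty[OF Orb]
  have Orb\<Omega>: "x \<in> nonwandering f" if "x \<in> Orb" for x
    using periodic_orbit_nonwandering[OF Orb] that by auto

  \<comment> \<open>Constants fixed before \<open>g\<close> and \<phi>\<close>
  obtain U\<^sub>1 K \<delta> \<kappa> where U\<^sub>1: "openin F U\<^sub>1" "f \<in> U\<^sub>1" and K: "0 < K" and \<delta>: "0 < \<delta>" and \<kappa>: "1 < \<kappa>"
    and rhe: "\<forall>g\<in>U\<^sub>1. \<forall>x\<in>nonwandering g. \<forall>y\<in>nonwandering g. \<forall>n::nat.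
           (MAX m\<in>{0..n}. dist ((g ^^ m) x) ((g ^^ m) y)) < \<delta> \<longrightarrow>
           (\<forall>m\<in>{0..n}. dist ((g ^^ m) x) ((g ^^ m) y)
              \<le> K * \<kappa> powr (- real (min m (n - m)))
                  * (dist x y + dist ((g ^^ n) x) ((g ^^ n) y)))"
    using RHE unfolding cond_RHE_def by blast
  obtain L where L: "0 < L"
    and ml: "\<And>\<phi>. holder_on \<alpha> UNIV \<phi> \<Longrightarrow>
           (\<exists>u. holder_on \<alpha> (nonwandering f) u \<and>
                (\<forall>x\<in>nonwandering f. \<phi> x + u x - u (f x) \<le> max_integral f \<phi>) \<and>
                holder_seminorm \<alpha> (nonwandering f) u \<le> L * holder_seminorm \<alpha> UNIV \<phi>)"
    using Mane \<alpha> unfolding cond_ML_def by blast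
  obtain r where r: "r > 0" "\<And>x y. x \<in> Orb \<Longrightarrow> y \<in> Orb \<Longrightarrow> x \<noteq> y \<Longrightarrow> r \<le> dist x y"
    using finite_imp_uniform_discrete[OF Orb_fin] unfolding uniform_discrete_def by (meson not_le)

  \<comment> \<open>Condition (IS) makes this a common Lipschitz constant for all \<open>g\<close>
    in \<open>U\<^sub>2\<close>.\<close>
  define \<Lambda> where "\<Lambda> = 2 * LIP f"
  have \<Lambda>: "0 \<le> \<Lambda>"
    using LIP_nonneg[OF lipm[OF assms(5)]] by (simp add: \<Lambda>_def)
  \<comment> \<open>The bound \<delta> makes (RHE) applicable; the other gives
    \<open>(1 + \<Lambda>) * \<rho> \<le> r / 2\<close>, the separation still left after
    \<open>h\<close> has moved every point by less than \<open>r / 4\<close>.\<close>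
  define \<rho> where "\<rho> = min \<delta> (r / (2 * (1 + \<Lambda>)))"
  have \<rho>: "0 < \<rho>" "\<rho> \<le> \<delta>"
    using \<delta> r \<Lambda> by (auto simp: \<rho>_def)
  have "(1 + \<Lambda>) * \<rho> \<le> (1 + \<Lambda>) * (r / (2 * (1 + \<Lambda>)))"
    using \<Lambda> by (intro mult_left_mono) (auto simp: \<rho>_def)
  also have "\<dots> = r / 2"
    using \<Lambda> by (simp add: field_simps)
  finally have \<rho>r: "(1 + \<Lambda>) * \<rho> \<le> r / 2" .
  have "0 < 2 * K * \<rho>" "0 < \<alpha> / 2"
    using K \<rho> \<alpha> by auto
  then obtain B where B: "0 \<le> B" "\<And>d. 0 < d \<Longrightarrow> d \<le> 1 \<Longrightarrow>
      \<exists>k::nat. 2 * K * \<rho> * \<kappa> powr (- real k) \<le> d \<and> real k * d powr (\<alpha> / 2) \<le> B"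
    using ex_exponent_with_small_log[OF _ \<kappa>] by blast
  define q where "q = \<kappa> powr (- \<alpha>)"
  have q: "0 < q" "q < 1"
    unfolding q_def using \<kappa> \<alpha> powr_less_mono[of "- \<alpha>" 0 \<kappa>] by auto
  define R where "R = 8 * B + 4 * card Orb + 2 + 2 / (1 - q) + 2 * L * (\<Lambda> + 3)"
  have "0 \<le> 2 / (1 - q)" "0 \<le> 2 * L * (\<Lambda> + 3)"
    using q L \<Lambda> by auto
  then have R: "0 < R"
    unfolding R_def using B(1) by linarith
  \<comment> \<open>With this choice \<open>C * \<rho> powr \<alpha> / 2\<close> equals
    \<open>R\<close>, the left side of the first condition in \<open>const\<close>.\<close>
  define C where "C = 2 * R / \<rho> powr \<alpha>"
  have C: "0 < C" "R \<le> C * \<rho> powr \<alpha> / 2"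
    using R \<rho> by (auto simp: C_def)
  define \<eta> where "\<eta> = (1 - q) * \<rho> powr \<alpha> / 20"
  have \<eta>: "0 < \<eta>" using q \<rho> by (simp add: \<eta>_def)
  \<comment> \<open>The bound 1 serves the exponent lemma, \<open>r / 4\<close> keeps the image of
    the orbit separated, and the last bound gives \<open>d powr \<alpha> \<le> \<eta>\<close>, where
    \<eta> is the value giving equality in the second condition of \<open>const\<close>.\<close>
  define \<epsilon> where "\<epsilon> = min (min 1 (r / 4)) (\<eta> powr (1 / \<alpha>))"
  have \<epsilon>: "0 < \<epsilon>" "\<epsilon> \<le> 1" "\<epsilon> \<le> r / 4" "\<epsilon> \<le> \<eta> powr (1 / \<alpha>)"
    using r \<eta> by (auto simp: \<epsilon>_def)
  have small: "10 * d powr \<alpha> / (1 - q) \<le> \<rho> powr \<alpha> / 2" if d: "0 < d" "d < \<epsilon>" for d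
  proof -
    have "d powr \<alpha> \<le> (\<eta> powr (1 / \<alpha>)) powr \<alpha>"
      using d \<epsilon> \<alpha> by (intro powr_mono2) auto
    also have "\<dots> = \<eta>"
      using \<alpha> \<eta> by (simp add: powr_powr)
    finally have "d powr \<alpha> \<le> \<eta>" .
    then show ?thesis
      using q by (simp add: \<eta>_def field_simps)
  qed
  obtain U\<^sub>2 where U\<^sub>2: "openin F U\<^sub>2" "f \<in> U\<^sub>2"
    and nbhd: "\<And>g. g \<in> U\<^sub>2 \<Longrightarrow> LIP g < 2 * LIP f \<and> (\<exists>h i. semiconj_pair \<epsilon> f g h i)"
    using IS[unfolded cond_IS_def, rule_format, OF \<epsilon>(1)] by (elim exE conjE) (rule that, auto)

  \<comment> \<open>The conclusion for one \<open>g\<close> and one \<phi>\<close>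
  have main: "maximizing_measures g
      (\<lambda>x. \<phi> x - 2 * C * holder_seminorm \<alpha> UNIV \<phi> * d powr (\<alpha> / 2) * infdist x (h ` Orb) powr \<alpha> + \<xi> x)
      = {orbit_measure (h ` Orb)}"
    if gU: "g \<in> U\<^sub>1" "g \<in> U\<^sub>2" and hi: "semiconj_pair \<epsilon> f g h i"
      and d: "d = max (sup_dist_id (nonwandering f) h) (sup_dist_id (nonwandering g) i)"
      and \<phi>: "holder_on \<alpha> UNIV \<phi>" "\<not> \<phi> constant_on UNIV" "maximizing_measures f \<phi> = {orbit_measure Orb}"
      and \<xi>: "holder_on \<alpha> UNIV \<xi>"
        "holder_seminorm \<alpha> UNIV \<xi> \<le> 5 * C * holder_seminorm \<alpha> UNIV \<phi> * d powr (\<alpha> / 2)"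
        "sup_norm \<xi> \<le> holder_seminorm \<alpha> UNIV \<phi> * d powr \<alpha>"
    for g h i d \<phi> \<xi>
  proof -
    have glip: "lipschitz_map g"
      using gU(1) openin_subset[OF U\<^sub>1(1)] by (intro lipm) auto
    note g = lipschitz_map_continuous[OF glip]
    have hd: "dist (h x) x \<le> d" if "x \<in> nonwandering f" for x
      unfolding d by (rule max.coboundedI1[OF dist_le_sup_dist_id[OF X that]])
    have id: "dist (i x) x \<le> d" if "x \<in> nonwandering g" for x
      unfolding d by (rule max.coboundedI2[OF dist_le_sup_dist_id[OF X that]])
    have h: "\<And>x. x \<in> nonwandering f \<Longrightarrow> h x \<in> nonwandering g" "\<And>x. x \<in> nonwandering f \<Longrightarrow> h (f x) = g (h x)"
      and i: "\<And>x. x \<in> nonwandering g \<Longrightarrow> i x \<in> nonwandering f" "\<And>x. x \<in> nonwandering g \<Longrightarrow> i (g x) = f (i x)"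
      and d\<epsilon>: "d < \<epsilon>"
      using hi by (auto simp: semiconj_pair_def d)
    obtain x\<^sub>0 where x\<^sub>0: "x\<^sub>0 \<in> Orb" using Orb_ne by auto
    have d0: "0 \<le> d"
      using hd[OF Orb\<Omega>[OF x\<^sub>0]] zero_le_dist[of "h x\<^sub>0" x\<^sub>0] by linarith
    define A where "A = holder_seminorm \<alpha> UNIV \<phi>"
    have A: "0 < A" unfolding A_def by (rule holder_seminorm_pos[OF \<phi>(1,2)])
    have \<xi>le: "\<bar>\<xi> x\<bar> \<le> A * d powr \<alpha>" for x
      using abs_le_sup_norm[OF X \<xi>(1) \<alpha>(1), of x] \<xi>(3) by (simp add: A_def)
    show ?thesis
      \<comment> \<open>If d = 0 then f and g agree on a common nonwandering set and \<xi> vanishes.\<close>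
    proof (cases "d = 0")
      case True
      then have hx: "h x = x" if "x \<in> nonwandering f" for x
        using hd[OF that] by simp
      have ix: "i x = x" if "x \<in> nonwandering g" for x
        using id[OF that] True by simp
      have "invariant_measures f \<subseteq> invariant_measures g"
      proof (rule invariant_measures_subset[OF X f g])
        fix x assume x: "x \<in> nonwandering f"
        show "f x = g x"
          using h(2)[OF x] hx[OF x] hx[OF nonwandering_forward_invariant[OF f x]] by simp
      qed
      moreover have "invariant_measures g \<subseteq> invariant_measures f"
      proof (rule invariant_measures_subset[OF X g f])
        fix x assume x: "x \<in> nonwandering g"
        show "g x = f x"
          using i(2)[OF x] ix[OF x] ix[OF nonwandering_forward_invariant[OF g x]] by simp
      qed
      ultimately have "invariant_measures f = invariant_measures g" by simp
      then have "maximizing_measures g \<phi> = {orbit_measure Orb}"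
        using \<phi>(3) by (simp add: maximizing_measures_def max_integral_def)
      moreover have "\<xi> x = 0" for x
        using \<xi>le[of x] True by simp
      moreover have "h ` Orb = Orb"
        using hx Orb\<Omega> by (simp add: image_def)
      \<comment> \<open>The penalty vanishes too, because \<open>0 powr (\<alpha> / 2)\<close> is
        0.\<close>
      ultimately show ?thesis
        using True by simp
    next
      case False
      then have d: "0 < d" "d \<le> 1"
        using d0 d\<epsilon> \<epsilon> by auto
      obtain u where u: "holder_on \<alpha> (nonwandering f) u"
        "\<And>x. x \<in> nonwandering f \<Longrightarrow> \<phi> x + u x - u (f x) \<le> max_integral f \<phi>"
        "holder_seminorm \<alpha> (nonwandering f) u \<le> L * A"
        using ml[OF \<phi>(1)] unfolding A_def by blast
      obtain k :: nat where k: "2 * K * \<rho> * \<kappa> powr (- real k) \<le> d" "real k * d powr (\<alpha> / 2) \<le> B"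
        using B(2)[OF d] by blast
      \<comment> \<open>Besides the separation, this yields injectivity of \<open>h\<close> on the
        orbit, so that its image has the same cardinality and \<open>C\<close> can be chosen from
        \<open>card Orb\<close>.\<close>
      have hsep: "r / 2 \<le> dist (h x) (h y)" if "x \<in> Orb" "y \<in> Orb" "x \<noteq> y" for x y
      proof -
        have "r \<le> dist x (h x) + dist (h x) (h y) + dist (h y) y"
          using r(2)[OF that] dist_triangle[of x y "h x"] dist_triangle[of "h x" y "h y"] by linarith
        then show ?thesis
          using hd[OF Orb\<Omega>[OF that(1)]] hd[OF Orb\<Omega>[OF that(2)]] d\<epsilon> \<epsilon>(3) by (simp add: dist_commute)
      qed
      have inj: "inj_on h Orb"
        using hsep r(1) by (intro inj_onI) (metis dist_self half_gt_zero not_le)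
      have card: "card (h ` Orb) = card Orb"
        by (rule card_image[OF inj])
      have \<phi>c: "continuous_on UNIV \<phi>" and \<xi>c: "continuous_on UNIV \<xi>"
        using holder_on_continuous \<phi>(1) \<xi>(1) \<alpha>(1) by blast+
      show ?thesis
        unfolding A_def[symmetric]
      proof (rule perturbed_maximizing_measures[where f = f and g = g and \<Lambda> = \<Lambda> and K = K and \<kappa> = \<kappa>
            and \<delta> = \<delta> and \<rho> = \<rho> and i = i and L = L and u = u and Q = "max_integral f \<phi>" and k = k and B = B])
        show "dist (g x) (g y) \<le> \<Lambda> * dist x y" for x y
        proof -
          have "dist (g x) (g y) \<le> LIP g * dist x y"
            by (rule dist_le_LIP[OF glip])
          also have "\<dots> \<le> \<Lambda> * dist x y"
            using nbhd[OF gU(2)] by (intro mult_right_mono) (auto simp: \<Lambda>_def)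
          finally show ?thesis .
        qed
        show "dist ((g ^^ m) x) ((g ^^ m) y)
            \<le> K * \<kappa> powr (- real (min m (n - m))) * (dist x y + dist ((g ^^ n) x) ((g ^^ n) y))"
          if "x \<in> nonwandering g" "y \<in> nonwandering g"
            "\<And>m. m \<le> n \<Longrightarrow> dist ((g ^^ m) x) ((g ^^ m) y) < \<delta>" "m \<le> n" for x y n m
        proof -
          have "(MAX m\<in>{0..n}. dist ((g ^^ m) x) ((g ^^ m) y)) < \<delta>"
            using that(3) by (subst Max_less_iff) auto
          then show ?thesis
            using rhe gU(1) that(1,2,4) by simp
        qed
        show "periodic_orbit g (h ` Orb)"
          using Orb f h(2) by (rule periodic_orbit_image)
        show "(1 + \<Lambda>) * \<rho> \<le> dist y y'" if "y \<in> h ` Orb" "y' \<in> h ` Orb" "y \<noteq> y'" for y y'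
          using that hsep \<rho>r by fastforce
        show "\<bar>\<phi> x - \<phi> y\<bar> \<le> A * dist x y powr \<alpha>" for x y
          unfolding A_def by (rule holder_bound[OF \<phi>(1)]) auto
        show "\<bar>u x - u y\<bar> \<le> L * A * dist x y powr \<alpha>"
          if "x \<in> nonwandering f" "y \<in> nonwandering f" for x y
          using holder_bound[OF u(1) that] mult_right_mono[OF u(3), of "dist x y powr \<alpha>"] by simp
        \<comment> \<open>The orbit measure being maximizing, \<open>Q\<close> is the average of
          \<phi> over \<open>Orb\<close>; moving each point by at most \<open>d\<close> lowers that
          average by at most \<open>A * d powr \<alpha>\<close>.\<close>
        show "max_integral f \<phi> - A * d powr \<alpha> \<le> sum \<phi> (h ` Orb) / card (h ` Orb)"
        proof -
          have p: "0 < card Orb" using Orb_fin Orb_ne by (simp add: card_gt_0_iff)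
          have "orbit_measure Orb \<in> maximizing_measures f \<phi>"
            by (simp add: \<phi>(3))
          then have "max_integral f \<phi> = integral\<^sup>L (orbit_measure Orb) \<phi>"
            by (simp add: maximizing_measures_def)
          also have "\<dots> = sum \<phi> Orb / card Orb"
            by (rule integral_orbit_measure[OF Orb_fin Orb_ne borel_measurable_continuous_onI[OF \<phi>c]])
          finally have Q: "card Orb * max_integral f \<phi> = sum \<phi> Orb"
            using p by simp
          have "(\<Sum>x\<in>Orb. \<phi> x - A * d powr \<alpha>) \<le> (\<Sum>x\<in>Orb. \<phi> (h x))"
          proof (rule sum_mono)
            fix x assume x: "x \<in> Orb"
            have "\<bar>\<phi> (h x) - \<phi> x\<bar> \<le> A * dist (h x) x powr \<alpha>"
              unfolding A_def by (rule holder_bound[OF \<phi>(1)]) auto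
            also have "\<dots> \<le> A * d powr \<alpha>"
              using hd[OF Orb\<Omega>[OF x]] A \<alpha> by (intro mult_left_mono powr_mono2) auto
            finally show "\<phi> x - A * d powr \<alpha> \<le> \<phi> (h x)" by linarith
          qed
          also have "\<dots> = sum \<phi> (h ` Orb)"
            by (simp add: sum.reindex[OF inj])
          finally have "card Orb * (max_integral f \<phi> - A * d powr \<alpha>) \<le> sum \<phi> (h ` Orb)"
            using Q by (simp add: sum_subtractf right_diff_distrib)
          then show ?thesis
            using p by (simp add: card pos_le_divide_eq mult.commute)
        qed
        show "\<bar>\<xi> x - \<xi> y\<bar> \<le> 5 * C * A * d powr (\<alpha> / 2) * dist x y powr \<alpha>" for x y
        proof -
          have "\<bar>\<xi> x - \<xi> y\<bar> \<le> holder_seminorm \<alpha> UNIV \<xi> * dist x y powr \<alpha>"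
            by (rule holder_bound[OF \<xi>(1)]) auto
          also have "\<dots> \<le> 5 * C * A * d powr (\<alpha> / 2) * dist x y powr \<alpha>"
            using \<xi>(2) unfolding A_def by (intro mult_right_mono) auto
          finally show ?thesis .
        qed
        show "8 * B + 4 * card (h ` Orb) + 2 + 2 / (1 - \<kappa> powr (- \<alpha>)) + 2 * L * (\<Lambda> + 3) \<le> C * \<rho> powr \<alpha> / 2"
          using C(2) unfolding R_def q_def card by simp
        show "10 * d powr \<alpha> / (1 - \<kappa> powr (- \<alpha>)) \<le> \<rho> powr \<alpha> / 2"
          using small[OF d(1) d\<epsilon>] unfolding q_def .
      qed (use X \<alpha> g \<Lambda> K \<kappa> \<rho> i id d A \<phi>c \<xi>c L u(2) C \<xi>le k in auto)
    qed
  qed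

  \<comment> \<open>Assembling the neighbourhood\<close>
  show ?thesis
  proof (rule exI[of _ "U\<^sub>1 \<inter> U\<^sub>2"], rule exI[of _ C], rule exI[of _ \<epsilon>], intro conjI ballI)
    show "openin F (U\<^sub>1 \<inter> U\<^sub>2)"
      by (rule openin_Int[OF U\<^sub>1(1) U\<^sub>2(1)])
    show "f \<in> U\<^sub>1 \<inter> U\<^sub>2" using U\<^sub>1 U\<^sub>2 by simp
    show "0 < C" "0 < \<epsilon>" by (rule C \<epsilon>)+
    fix g assume g: "g \<in> U\<^sub>1 \<inter> U\<^sub>2"
    then show "\<exists>h i. semiconj_pair \<epsilon> f g h i" using nbhd by simp
    show "\<forall>h i. semiconj_pair \<epsilon> f g h i \<longrightarrow>
        (let Orb_g = h ` Orb;
             d_g = max (sup_dist_id (nonwandering f) h) (sup_dist_id (nonwandering g) i)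
         in \<forall>\<phi>. holder_on \<alpha> UNIV \<phi> \<and> \<not> \<phi> constant_on UNIV \<and>
                 maximizing_measures f \<phi> = {orbit_measure Orb} \<longrightarrow>
              (\<forall>\<xi>. holder_on \<alpha> UNIV \<xi> \<and>
                    holder_seminorm \<alpha> UNIV \<xi>
                      \<le> 5 * C * holder_seminorm \<alpha> UNIV \<phi> * d_g powr (\<alpha> / 2) \<and>
                    sup_norm \<xi> \<le> holder_seminorm \<alpha> UNIV \<phi> * d_g powr \<alpha> \<longrightarrow>
                 {orbit_measure Orb_g} =
                 maximizing_measures g
                   (\<lambda>x. \<phi> x
                      - 2 * C * holder_seminorm \<alpha> UNIV \<phi> * d_g powr (\<alpha> / 2)
                          * infdist x Orb_g powr \<alpha>
                      + \<xi> x)))"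
      unfolding Let_def
      by (intro allI impI, elim conjE, rule main[symmetric]) (use g in auto)
  qed
qed

end
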